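(* Let $A$ be a quasinilpotent unicellular bounded linear operator on a complex Hilbert space. Let $f$ be an analytic function on an open subset of $\mathbb C$ containing the origin, with $f'(0)\ne0$. Then $f(A)$ is also unicellular.
   Context: A bounded operator $A$ is quasinilpotent if its spectrum is $\sigma(A)=\{0\}$. It is unicellular if its closed invariant subspaces are totally ordered by inclusion. $f(A)$ is defined by the Riesz–Dunford (holomorphic) functional calculus. *)

theory Defs
  imports "HOL-Complex_Analysis.Complex_Analysis"
begin

section \<open>Complex Hilbert spaces\<close>

class scaleC =
  fixes scaleC :: "complex \<Rightarrow> 'a \<Rightarrow> 'a"  (infixr "*\<^sub>C" 75)

text \<open>The inner product is linear in the first argument and antilinear in the second; the norm
  and the real vector space structure are those induced by the complex structure.\<close>

class complex_inner = real_normed_vector + scaleC +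
  fixes cinner :: "'a \<Rightarrow> 'a \<Rightarrow> complex"
  assumes scaleC_add_right: "c *\<^sub>C (x + y) = c *\<^sub>C x + c *\<^sub>C y"
    and scaleC_add_left: "(c + d) *\<^sub>C x = c *\<^sub>C x + d *\<^sub>C x"
    and scaleC_scaleC: "c *\<^sub>C d *\<^sub>C x = (c * d) *\<^sub>C x"
    and scaleC_one: "1 *\<^sub>C x = x"
    and scaleR_scaleC: "r *\<^sub>R x = complex_of_real r *\<^sub>C x"
    and cinner_commute: "cinner x y = cnj (cinner y x)"
    and cinner_add_left: "cinner (x + y) z = cinner x z + cinner y z"
    and cinner_scaleC_left: "cinner (c *\<^sub>C x) y = c * cinner x y"
    and cinner_nonneg: "0 \<le> Re (cinner x x)"
    and cinner_eq_zero_iff: "cinner x x = 0 \<longleftrightarrow> x = 0"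
    and norm_eq_sqrt_cinner: "norm x = sqrt (Re (cinner x x))"

class complex_hilbert = complex_inner + banach

instantiation complex :: complex_hilbert
begin

definition scaleC_complex :: "complex \<Rightarrow> complex \<Rightarrow> complex"
  where "scaleC_complex c x = c * x"

definition cinner_complex :: "complex \<Rightarrow> complex \<Rightarrow> complex"
  where "cinner_complex x y = x * cnj y"

instance
proof
  fix x :: complex
  show "norm x = sqrt (Re (cinner x x))"
    by (simp add: cinner_complex_def cmod_def power2_eq_square)
qed (auto simp: scaleC_complex_def cinner_complex_def algebra_simps scaleR_conv_of_real)

end

lemma norm_scaleC: "norm (c *\<^sub>C x) = norm c * norm (x :: 'a::complex_inner)"
proof -
  have "cinner (c *\<^sub>C x) (c *\<^sub>C x) = c * cnj (c * cinner x x)"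
    by (metis cinner_commute cinner_scaleC_left)
  also have "\<dots> = c * cnj c * cinner x x"
    by (metis cinner_commute complex_cnj_mult mult.assoc)
  also have "c * cnj c = of_real ((norm c)\<^sup>2)"
    by (rule complex_norm_square[symmetric])
  finally have "Re (cinner (c *\<^sub>C x) (c *\<^sub>C x)) = (norm c)\<^sup>2 * Re (cinner x x)"
    by simp
  then show ?thesis
    by (simp only: norm_eq_sqrt_cinner[of x] norm_eq_sqrt_cinner[of "c *\<^sub>C x"] real_sqrt_mult
        real_sqrt_abs abs_norm_cancel)
qed

lemma bounded_linear_scaleC: "bounded_linear (\<lambda>x :: 'a::complex_inner. c *\<^sub>C x)"
proof (rule bounded_linear_intro)
  fix r and x :: 'a
  show "c *\<^sub>C (r *\<^sub>R x) = r *\<^sub>R (c *\<^sub>C x)"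
    by (simp add: scaleR_scaleC scaleC_scaleC mult.commute)
  show "norm (c *\<^sub>C x) \<le> norm x * norm c"
    by (simp add: norm_scaleC mult.commute)
qed (rule scaleC_add_right)

section \<open>Bounded operators\<close>

text \<open>The type of bounded operators from the library only guarantees real linearity, so a bounded
  operator on a complex Hilbert space is an element satisfying the following predicate.\<close>

definition complex_linear :: "('a::complex_hilbert \<Rightarrow>\<^sub>L 'a) \<Rightarrow> bool"
  where "complex_linear A \<longleftrightarrow> (\<forall>c x. blinfun_apply A (c *\<^sub>C x) = c *\<^sub>C blinfun_apply A x)"

lift_definition scalar_op :: "complex \<Rightarrow> 'a::complex_hilbert \<Rightarrow>\<^sub>L 'a"
  is "\<lambda>c x. c *\<^sub>C x"
  by (rule bounded_linear_scaleC)

definition is_inverse_op :: "('a::complex_hilbert \<Rightarrow>\<^sub>L 'a) \<Rightarrow> ('a \<Rightarrow>\<^sub>L 'a) \<Rightarrow> bool"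
  where "is_inverse_op T S \<longleftrightarrow>
    complex_linear S \<and> S o\<^sub>L T = id_blinfun \<and> T o\<^sub>L S = id_blinfun"

definition spectrum :: "('a::complex_hilbert \<Rightarrow>\<^sub>L 'a) \<Rightarrow> complex set"
  where "spectrum A = {z. \<not> (\<exists>S. is_inverse_op (scalar_op z - A) S)}"

definition resolvent :: "('a::complex_hilbert \<Rightarrow>\<^sub>L 'a) \<Rightarrow> complex \<Rightarrow> 'a \<Rightarrow>\<^sub>L 'a"
  where "resolvent A z = (THE S. is_inverse_op (scalar_op z - A) S)"

definition quasinilpotent :: "('a::complex_hilbert \<Rightarrow>\<^sub>L 'a) \<Rightarrow> bool"
  where "quasinilpotent A \<longleftrightarrow> spectrum A = {0}"

definition complex_subspace :: "'a::complex_hilbert set \<Rightarrow> bool"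
  where "complex_subspace M \<longleftrightarrow>
    0 \<in> M \<and> (\<forall>x\<in>M. \<forall>y\<in>M. x + y \<in> M) \<and> (\<forall>c. \<forall>x\<in>M. c *\<^sub>C x \<in> M)"

definition closed_invariant_subspace :: "('a::complex_hilbert \<Rightarrow>\<^sub>L 'a) \<Rightarrow> 'a set \<Rightarrow> bool"
  where "closed_invariant_subspace A M \<longleftrightarrow>
    complex_subspace M \<and> closed M \<and> blinfun_apply A ` M \<subseteq> M"

definition unicellular :: "('a::complex_hilbert \<Rightarrow>\<^sub>L 'a) \<Rightarrow> bool"
  where "unicellular A \<longleftrightarrow>
    (\<forall>M N. closed_invariant_subspace A M \<longrightarrow> closed_invariant_subspace A N \<longrightarrow>
      M \<subseteq> N \<or> N \<subseteq> M)"

section \<open>The Riesz--Dunford functional calculus\<close>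

text \<open>A cycle, i.e. a finite list of piecewise continuously differentiable closed paths,
  surrounds \<open>K\<close> in \<open>U\<close>. Several paths are needed in general, since neither \<open>K\<close> nor \<open>U\<close> has to be
  connected.\<close>

definition surrounds :: "(real \<Rightarrow> complex) list \<Rightarrow> complex set \<Rightarrow> complex set \<Rightarrow> bool"
  where "surrounds \<Gamma> K U \<longleftrightarrow>
    (\<forall>\<gamma>\<in>set \<Gamma>. valid_path \<gamma> \<and> pathfinish \<gamma> = pathstart \<gamma> \<and> path_image \<gamma> \<subseteq> U - K) \<and>
    (\<forall>z\<in>K. (\<Sum>\<gamma>\<leftarrow>\<Gamma>. winding_number \<gamma> z) = 1) \<and>
    (\<forall>z. z \<notin> U \<longrightarrow> (\<Sum>\<gamma>\<leftarrow>\<Gamma>. winding_number \<gamma> z) = 0)"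

text \<open>The operator-valued analogue of \<^const>\<open>contour_integral\<close>, applied to
  \<open>f(z) (z - A)\<^sup>-\<^sup>1\<close>; the integral is taken in the Banach space of bounded operators.\<close>

definition resolvent_integral ::
    "(complex \<Rightarrow> complex) \<Rightarrow> ('a::complex_hilbert \<Rightarrow>\<^sub>L 'a) \<Rightarrow> (real \<Rightarrow> complex) \<Rightarrow> 'a \<Rightarrow>\<^sub>L 'a"
  where "resolvent_integral f A \<gamma> =
    integral {0..1} (\<lambda>t.
      scalar_op (f (\<gamma> t) * vector_derivative \<gamma> (at t within {0..1})) o\<^sub>L resolvent A (\<gamma> t))"

text \<open>Intended for \<open>f\<close> analytic on the open set \<open>U\<close> with \<open>spectrum A \<subseteq> U\<close>; then a surrounding cycle
  exists, and by Cauchy's theorem the value does not depend on which one is chosen.\<close>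

definition riesz_dunford ::
    "complex set \<Rightarrow> (complex \<Rightarrow> complex) \<Rightarrow> ('a::complex_hilbert \<Rightarrow>\<^sub>L 'a) \<Rightarrow> 'a \<Rightarrow>\<^sub>L 'a"
  where "riesz_dunford U f A =
    (let \<Gamma> = SOME \<Gamma>. surrounds \<Gamma> (spectrum A) U
     in scalar_op (1 / (2 * of_real pi * \<i>)) o\<^sub>L (\<Sum>\<gamma>\<leftarrow>\<Gamma>. resolvent_integral f A \<gamma>))"

end

theory Submission
  imports Defs
begin

text \<open>
  Since \<^term>\<open>A\<close> is quasinilpotent, the norms of its powers decay faster than any geometric sequence, so
  \<open>\<phi> \<mapsto> \<phi>(A) = \<Sum>n. a\<^sub>n A\<^sup>n\<close> (with \<open>a\<^sub>n\<close> the Taylor coefficients of \<open>\<phi>\<close> at 0) is defined for all germs \<open>\<phi>\<close>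
  of holomorphic functions at 0, is multiplicative, and is continuous with respect to uniform
  convergence on a small circle. As \<open>f'(0) \<noteq> 0\<close>, the function \<open>f - f(0)\<close> has a local inverse \<open>g\<close>;
  the Taylor polynomials \<open>g\<^sub>m\<close> of \<open>g\<close> satisfy \<open>g\<^sub>m(f - f(0)) \<longrightarrow> z\<close> uniformly near 0, hence
  \<open>g\<^sub>m(f(A) - f(0)) \<longrightarrow> A\<close> in norm. Thus every closed invariant subspace of \<open>f(A)\<close> is invariant
  under \<open>A\<close>, and these are totally ordered.
\<close>

section \<open>Cauchy's theorem for cycles\<close>

text \<open>The obstacle is that \<open>riesz_dunford\<close> integrates over whichever surrounding
  cycle \<open>SOME\<close> picks. The set \<open>U\<close> may be disconnected or have holes, and
  the cycle may contain loops in components away from 0 or loops whose winding numbers cancel only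
  in the sum. So the power series is matched with the contour integral for every such cycle: the
  Neumann series of the resolvent is integrated term by term, and a Cauchy theorem for cycles turns
  the integrals of \<open>f z / z ^ Suc n\<close> into Taylor coefficients. The decay of the powers
  comes from the inverse of I - zA, which exists for every z since the spectrum is {0}. Its matrix
  coefficients are entire functions, and Cauchy's inequality applies to them on circles of every
  radius. The value f(0) is subtracted because the local inverse is expanded at 0; a scalar shift
  does not change the invariant subspaces. Taylor polynomials of the inverse are used because
  polynomials in f(A) visibly preserve the invariant subspaces of f(A), and closedness lets this
  pass to limits.\<close>

text \<open>Each loop is reached from \<open>a\<close> along a path that is then run backwards, so
  the two passes cancel in every contour integral. One \<open>g\<close> serves all \<open>h\<close>,
  so the winding numbers of \<open>g\<close> can be read off as well.\<close>

lemma merge_loops: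
  fixes \<Gamma> :: "(real \<Rightarrow> complex) list"
  assumes S: "open S" "connected S" "a \<in> S"
    and \<Gamma>: "\<And>\<gamma>. \<gamma> \<in> set \<Gamma> \<Longrightarrow> valid_path \<gamma> \<and> pathfinish \<gamma> = pathstart \<gamma> \<and> path_image \<gamma> \<subseteq> S"
  shows "\<exists>g. valid_path g \<and> pathstart g = a \<and> pathfinish g = a \<and> path_image g \<subseteq> S \<and>
    (\<forall>h. h holomorphic_on S \<longrightarrow> contour_integral g h = (\<Sum>\<gamma>\<leftarrow>\<Gamma>. contour_integral \<gamma> h))"
  using \<Gamma>
proof (induction \<Gamma>)
  case Nil
  show ?case
  proof (intro exI conjI allI impI)
    show "path_image (linepath a a) \<subseteq> S" using S by simp
    show "contour_integral (linepath a a) h = (\<Sum>\<gamma>\<leftarrow>[]. contour_integral \<gamma> h)" for h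
      by (simp only: contour_integral_trivial list.map sum_list.Nil)
  qed (simp_all only: valid_path_linepath pathstart_linepath pathfinish_linepath)
next
  case (Cons \<gamma> \<Gamma>)
  then obtain g where g: "valid_path g" "pathstart g = a" "pathfinish g = a" "path_image g \<subseteq> S"
    "\<And>h. h holomorphic_on S \<Longrightarrow> contour_integral g h = (\<Sum>\<gamma>\<leftarrow>\<Gamma>. contour_integral \<gamma> h)"
    by auto
  have \<gamma>: "valid_path \<gamma>" "pathfinish \<gamma> = pathstart \<gamma>" "path_image \<gamma> \<subseteq> S"
    using Cons.prems by auto
  then have "pathstart \<gamma> \<in> S" by blast
  \<comment> \<open>A polynomial connecting path is smooth, which keeps the joined path
    \<open>q\<close> valid.\<close>
  then obtain p where "polynomial_function p" and p: "path_image p \<subseteq> S" "pathstart p = a"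
      "pathfinish p = pathstart \<gamma>"
    using connected_open_polynomial_connected[OF S(1,2,3)] by blast
  then have vp: "valid_path p"
    by (simp add: valid_path_polynomial_function)
  define q where "q = p +++ \<gamma> +++ reversepath p +++ g"
  have "contour_integral q h = (\<Sum>\<gamma>\<leftarrow>\<gamma> # \<Gamma>. contour_integral \<gamma> h)" if h: "h holomorphic_on S" for h
  proof -
    have "h contour_integrable_on p" "h contour_integrable_on \<gamma>" "h contour_integrable_on g"
      using contour_integrable_holomorphic_simple[OF h S(1)] p g \<gamma> vp by auto
    then show ?thesis
      using vp p g \<gamma> h unfolding q_def
      by (simp add: contour_integrable_reversepath contour_integral_reversepath)
  qed
  moreover have "valid_path q" "pathstart q = a" "pathfinish q = a" "path_image q \<subseteq> S"
    using vp p g \<gamma> unfolding q_def by (auto simp: path_image_join)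
  ultimately show ?case by blast
qed

text \<open>The library has the homology form of Cauchy's theorem for a single closed path only.\<close>

lemma Cauchy_theorem_cycle_connected:
  fixes \<Gamma> :: "(real \<Rightarrow> complex) list"
  assumes S: "open S" "connected S" and h: "h holomorphic_on S"
    and \<Gamma>: "\<And>\<gamma>. \<gamma> \<in> set \<Gamma> \<Longrightarrow> valid_path \<gamma> \<and> pathfinish \<gamma> = pathstart \<gamma> \<and> path_image \<gamma> \<subseteq> S"
    and wn: "\<And>z. z \<notin> S \<Longrightarrow> (\<Sum>\<gamma>\<leftarrow>\<Gamma>. winding_number \<gamma> z) = 0"
  shows "(\<Sum>\<gamma>\<leftarrow>\<Gamma>. contour_integral \<gamma> h) = 0"
proof (cases "\<Gamma> = []")
  case False
  then obtain \<gamma> where "\<gamma> \<in> set \<Gamma>" by (meson hd_in_set)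
  then have "pathstart \<gamma> \<in> S" using \<Gamma> by blast
  then obtain g where g: "valid_path g" "pathfinish g = pathstart g" "path_image g \<subseteq> S"
    "\<And>h. h holomorphic_on S \<Longrightarrow> contour_integral g h = (\<Sum>\<gamma>\<leftarrow>\<Gamma>. contour_integral \<gamma> h)"
    using merge_loops[OF S _ \<Gamma>] by metis
  \<comment> \<open>The merging identity is applied to 1/(w - z), which is holomorphic on
    \<open>S\<close> because z lies outside.\<close>
  have "winding_number g z = 0" if z: "z \<notin> S" for z
  proof -
    have "(\<lambda>w. 1 / (w - z)) holomorphic_on S"
      using z by (intro holomorphic_intros) auto
    then have *: "contour_integral g (\<lambda>w. 1 / (w - z)) = (\<Sum>\<gamma>\<leftarrow>\<Gamma>. contour_integral \<gamma> (\<lambda>w. 1 / (w - z)))"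
      using g by blast
    have "winding_number \<gamma> z = 1 / (2 * pi * \<i>) * contour_integral \<gamma> (\<lambda>w. 1 / (w - z))" if "\<gamma> \<in> set \<Gamma>" for \<gamma>
      using winding_number_valid_path[of \<gamma> z] \<Gamma>[OF that] z by auto
    then have "(\<Sum>\<gamma>\<leftarrow>\<Gamma>. winding_number \<gamma> z) = (\<Sum>\<gamma>\<leftarrow>\<Gamma>. 1 / (2 * pi * \<i>) * contour_integral \<gamma> (\<lambda>w. 1 / (w - z)))"
      by (intro arg_cong[where f = sum_list] map_cong) auto
    also have "\<dots> = 1 / (2 * pi * \<i>) * contour_integral g (\<lambda>w. 1 / (w - z))"
      unfolding * by (rule sum_list_const_mult)
    also have "\<dots> = winding_number g z"
      using winding_number_valid_path[of g z] g(1,3) z by (subst winding_number_valid_path) auto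
    finally show ?thesis using wn[OF z] by simp
  qed
  then have "(h has_contour_integral 0) g"
    using g h S by (intro Cauchy_theorem_global) auto
  then show ?thesis
    using g(4)[OF h] contour_integral_unique by auto
qed simp

text \<open>Take for q the point of the segment from \<open>d\<close> to \<open>z\<close> within
  \<open>closure S\<close> that is nearest to \<open>z\<close>. Beyond q the segment has left
  \<open>closure S\<close>, and q is not in the open set \<open>S\<close>, since otherwise a small
  step towards \<open>z\<close> would stay in \<open>S\<close>.\<close>

lemma frontier_point_on_segment:
  fixes S :: "'a::euclidean_space set"
  assumes S: "open S" "d \<in> S" and z: "z \<notin> S"
  shows "\<exists>q \<in> closure S - S. closed_segment q z \<inter> S = {}"
proof -
  let ?K = "closed_segment d z \<inter> closure S"
  have "closed ?K" "?K \<noteq> {}"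
    using S(2) closure_subset[of S] by auto
  then obtain q where q: "q \<in> ?K" and min: "\<And>x. x \<in> ?K \<Longrightarrow> dist z q \<le> dist z x"
    using distance_attains_inf[of ?K z] by blast
  have sub: "closed_segment q z \<subseteq> closed_segment d z"
    using q by (simp add: subset_closed_segment)
  have far: "x = q" if "x \<in> closed_segment q z" "x \<in> closure S" for x
  proof (rule ccontr)
    assume "x \<noteq> q"
    then have "dist x z < dist q z"
      using between[of q z x] that(1) by (metis add_less_same_cancel2 between_mem_segment dist_nz linorder_not_less
        add_le_same_cancel2 zero_less_dist_iff dist_commute)
    moreover have "x \<in> ?K" using that sub by auto
    ultimately show False using min[of x] by (simp add: dist_commute)
  qed
  have "q \<notin> S"
  proof
    assume "q \<in> S"
    then have "q \<noteq> z" using z by blast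
    obtain e where e: "e > 0" "ball q e \<subseteq> S" using \<open>q \<in> S\<close> S(1) openE by blast
    \<comment> \<open>Moves \<open>q\<close> by at most e/2, hence within the ball; the minimum with
      1 prevents overshooting \<open>z\<close>.\<close>
    define t where "t = min 1 (e / (2 * norm (z - q)))"
    let ?x = "q + t *\<^sub>R (z - q)"
    have n: "norm (z - q) > 0" using \<open>q \<noteq> z\<close> by simp
    have t: "0 < t" "t \<le> 1" "t * norm (z - q) < e"
    proof -
      show "0 < t" "t \<le> 1" using e n by (auto simp: t_def)
      have "t * norm (z - q) \<le> e / (2 * norm (z - q)) * norm (z - q)"
        by (intro mult_right_mono) (auto simp: t_def)
      also have "\<dots> < e" using e n by (simp add: field_simps)
      finally show "t * norm (z - q) < e" .
    qed
    have "?x \<in> closed_segment q z"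
      using t unfolding closed_segment_def by (auto simp: algebra_simps intro!: exI[of _ t])
    moreover have "?x \<in> S"
      using e t by (auto simp: dist_norm)
    ultimately have "?x = q" using far closure_subset by blast
    then show False using t \<open>q \<noteq> z\<close> by simp
  qed
  moreover have "closed_segment q z \<inter> S = {}"
    using far closure_subset[of S] \<open>q \<notin> S\<close> by blast
  ultimately show ?thesis using q by blast
qed

text \<open>
  The winding sum of \<open>\<Gamma>2\<close> is constant on \<^term>\<open>closure D\<close>, and it vanishes at some point there: walk from \<open>D\<close>
  towards infinity to a boundary point of \<open>D\<close> from which the rest of the walk avoids \<open>D\<close>, so that the winding
  sum of \<open>\<Gamma>1\<close> is zero at that point. Hence the winding sum of \<open>\<Gamma>1\<close> vanishes on the boundary of \<open>D\<close>.
\<close>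

lemma winding_sum_zero_outside_component:
  fixes \<Gamma>1 \<Gamma>2 :: "(real \<Rightarrow> complex) list"
  assumes D: "open D" "D \<noteq> {}" "connected D" "closure D \<inter> U \<subseteq> D"
    and \<Gamma>1: "\<And>\<gamma>. \<gamma> \<in> set \<Gamma>1 \<Longrightarrow> path \<gamma> \<and> pathfinish \<gamma> = pathstart \<gamma> \<and> path_image \<gamma> \<subseteq> D"
    and \<Gamma>2: "\<And>\<gamma>. \<gamma> \<in> set \<Gamma>2 \<Longrightarrow> path \<gamma> \<and> pathfinish \<gamma> = pathstart \<gamma> \<and> path_image \<gamma> \<subseteq> U - D"
    and total: "\<And>z. z \<notin> U \<Longrightarrow> (\<Sum>\<gamma>\<leftarrow>\<Gamma>1. winding_number \<gamma> z) + (\<Sum>\<gamma>\<leftarrow>\<Gamma>2. winding_number \<gamma> z) = 0"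
    and z: "z \<notin> D"
  shows "(\<Sum>\<gamma>\<leftarrow>\<Gamma>1. winding_number \<gamma> z) = 0"
proof -
  define n1 where "n1 z = (\<Sum>\<gamma>\<leftarrow>\<Gamma>1. winding_number \<gamma> z)" for z
  define n2 where "n2 z = (\<Sum>\<gamma>\<leftarrow>\<Gamma>2. winding_number \<gamma> z)" for z
  obtain d where d: "d \<in> D" using D by blast
  have const1: "n1 u = n1 v" if "connected S" "S \<inter> D = {}" "u \<in> S" "v \<in> S" for S u v
    unfolding n1_def
  proof (intro arg_cong[where f = sum_list] map_cong refl)
    fix \<gamma> assume \<gamma>: "\<gamma> \<in> set \<Gamma>1"
    have "winding_number \<gamma> constant_on S"
      by (rule winding_number_constant) (use \<Gamma>1[OF \<gamma>] that in auto)
    then show "winding_number \<gamma> u = winding_number \<gamma> v"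
      using that by (auto simp: constant_on_def)
  qed
  \<comment> \<open>Points of \<open>closure D\<close> outside \<open>D\<close> lie outside
    \<open>U\<close>, so the connected set \<open>closure D\<close> misses every path of
    \<open>\<Gamma>2\<close>.\<close>
  have const2: "n2 u = n2 v" if "u \<in> closure D" "v \<in> closure D" for u v
    unfolding n2_def
  proof (intro arg_cong[where f = sum_list] map_cong refl)
    fix \<gamma> assume \<gamma>: "\<gamma> \<in> set \<Gamma>2"
    have "winding_number \<gamma> constant_on closure D"
      by (rule winding_number_constant) (use \<Gamma>2[OF \<gamma>] D connected_imp_connected_closure in auto)
    then show "winding_number \<gamma> u = winding_number \<gamma> v"
      using that by (auto simp: constant_on_def)
  qed
  have "\<exists>w. \<forall>\<gamma> \<in> set (\<Gamma>1 @ \<Gamma>2). winding_number \<gamma> w = 0"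
  proof -
    have "\<forall>\<gamma>. \<exists>B. \<gamma> \<in> set (\<Gamma>1 @ \<Gamma>2) \<longrightarrow> (\<forall>z. B \<le> norm z \<longrightarrow> winding_number \<gamma> z = 0)"
      using winding_number_zero_at_infinity \<Gamma>1 \<Gamma>2 by (metis Un_iff set_append)
    then obtain B where B: "\<And>\<gamma> z. \<gamma> \<in> set (\<Gamma>1 @ \<Gamma>2) \<Longrightarrow> B \<gamma> \<le> norm z \<Longrightarrow> winding_number \<gamma> z = 0"
      by metis
    define M where "M = Max (insert 0 (B ` set (\<Gamma>1 @ \<Gamma>2)))"
    have "M \<ge> 0" unfolding M_def by (intro Max_ge) auto
    moreover have "B \<gamma> \<le> M" if "\<gamma> \<in> set (\<Gamma>1 @ \<Gamma>2)" for \<gamma>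
      unfolding M_def using that by (intro Max_ge) auto
    ultimately have "\<forall>\<gamma> \<in> set (\<Gamma>1 @ \<Gamma>2). winding_number \<gamma> (of_real M) = 0"
      using B by simp
    then show ?thesis by blast
  qed
  then obtain w where "\<forall>\<gamma> \<in> set (\<Gamma>1 @ \<Gamma>2). winding_number \<gamma> w = 0" by blast
  then have w: "n1 w = 0" "n2 w = 0"
    by (simp_all add: n1_def n2_def cong: map_cong)
  \<comment> \<open>\<open>D\<close> may be unbounded, so the far point \<open>w\<close> can lie in
    \<open>D\<close> itself and then serves as \<open>p\<close>. Otherwise the boundary point
    \<open>q\<close> is outside \<open>U\<close>, where the two winding sums cancel.\<close>
  obtain p where p: "p \<in> closure D" "n2 p = 0"
  proof (cases "w \<in> D")
    case True
    then show ?thesis using that w closure_subset by blast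
  next
    case False
    then obtain q where q: "q \<in> closure D - D" "closed_segment q w \<inter> D = {}"
      using frontier_point_on_segment[OF D(1) d] by blast
    then have "n1 q = 0"
      using const1[of "closed_segment q w" q w] w by simp
    moreover have "q \<notin> U" using q D by blast
    ultimately have "n2 q = 0" using total[of q] by (simp add: n1_def n2_def)
    then show ?thesis using that q by blast
  qed
  obtain q where q: "q \<in> closure D - D" "closed_segment q z \<inter> D = {}"
    using frontier_point_on_segment[OF D(1) d z] by blast
  then have "q \<notin> U" using D by blast
  moreover have "n2 q = 0" using const2[of q p] p q by simp
  ultimately have "n1 q = 0" using total[of q] by (simp add: n1_def n2_def)
  then show ?thesis
    using const1[of "closed_segment q z" q z] q by (simp add: n1_def)
qed

lemma sum_list_filter_split:
  fixes g :: "'a \<Rightarrow> 'b::comm_monoid_add"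
  shows "(\<Sum>x\<leftarrow>xs. g x) = (\<Sum>x\<leftarrow>filter P xs. g x) + (\<Sum>x\<leftarrow>filter (\<lambda>x. \<not> P x) xs. g x)"
  by (induction xs) (auto simp: algebra_simps)

text \<open>Induction on the number of paths, needed because \<open>U\<close> may be disconnected.
  All paths in the component \<open>D\<close> of the first path are split off; by the preceding
  winding lemma they are null-homologous in \<open>D\<close> on their own, so the connected case
  applies to them, and the shorter remainder satisfies the hypotheses again.\<close>

proposition Cauchy_theorem_cycle:
  fixes \<Gamma> :: "(real \<Rightarrow> complex) list"
  assumes U: "open U" and h: "h holomorphic_on U"
    and \<Gamma>: "\<And>\<gamma>. \<gamma> \<in> set \<Gamma> \<Longrightarrow> valid_path \<gamma> \<and> pathfinish \<gamma> = pathstart \<gamma> \<and> path_image \<gamma> \<subseteq> U"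
    and wn: "\<And>z. z \<notin> U \<Longrightarrow> (\<Sum>\<gamma>\<leftarrow>\<Gamma>. winding_number \<gamma> z) = 0"
  shows "(\<Sum>\<gamma>\<leftarrow>\<Gamma>. contour_integral \<gamma> h) = 0"
  using \<Gamma> wn
proof (induction \<Gamma> rule: length_induct)
  case (1 \<Gamma>)
  show ?case
  proof (cases \<Gamma>)
    case (Cons \<gamma>0 \<Gamma>')
    define a where "a = pathstart \<gamma>0"
    define D where "D = connected_component_set U a"
    have "a \<in> U" using "1.prems"(1)[of \<gamma>0] Cons by (auto simp: a_def)
    then have a: "a \<in> D" unfolding D_def by simp
    have D: "open D" "connected D" "D \<subseteq> U"
      using U by (auto simp: D_def open_connected_component connected_component_subset)
    \<comment> \<open>Components are relatively closed, so the boundary of \<open>D\<close> lies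
      outside \<open>U\<close>, where the total winding sum vanishes.\<close>
    obtain T where "closed T" "D = U \<inter> T"
      using closedin_connected_component[of U a] by (auto simp: D_def closedin_closed)
    then have clD: "closure D \<inter> U \<subseteq> D"
      using closure_minimal[of D T] by auto
    define \<Gamma>1 where "\<Gamma>1 = filter (\<lambda>\<gamma>. path_image \<gamma> \<subseteq> D) \<Gamma>"
    define \<Gamma>2 where "\<Gamma>2 = filter (\<lambda>\<gamma>. \<not> path_image \<gamma> \<subseteq> D) \<Gamma>"
    have disj: "path_image \<gamma> \<subseteq> U - D" if "\<gamma> \<in> set \<Gamma>2" for \<gamma>
    proof -
      have \<gamma>: "\<gamma> \<in> set \<Gamma>" "\<not> path_image \<gamma> \<subseteq> D" using that by (auto simp: \<Gamma>2_def)
      then have "connected (path_image \<gamma>)" "path_image \<gamma> \<subseteq> U"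
        using "1.prems"(1) by (auto simp: connected_path_image valid_path_imp_path)
      moreover have "path_image \<gamma> \<subseteq> D" if "x \<in> path_image \<gamma>" "x \<in> D" for x
        using connected_component_maximal[OF that(1) calculation] connected_component_eq that(2)
        unfolding D_def by metis
      ultimately show ?thesis using \<gamma>(2) by blast
    qed
    have split: "(\<Sum>\<gamma>\<leftarrow>\<Gamma>. g \<gamma>) = (\<Sum>\<gamma>\<leftarrow>\<Gamma>1. g \<gamma>) + (\<Sum>\<gamma>\<leftarrow>\<Gamma>2. g \<gamma>)" for g :: "(real \<Rightarrow> complex) \<Rightarrow> complex"
      unfolding \<Gamma>1_def \<Gamma>2_def by (rule sum_list_filter_split)
    have mem: "\<gamma> \<in> set \<Gamma>" if "\<gamma> \<in> set \<Gamma>1 \<or> \<gamma> \<in> set \<Gamma>2" for \<gamma>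
      using that by (auto simp: \<Gamma>1_def \<Gamma>2_def)
    have wn1: "(\<Sum>\<gamma>\<leftarrow>\<Gamma>1. winding_number \<gamma> z) = 0" if "z \<notin> D" for z
    proof (rule winding_sum_zero_outside_component[where D = D and U = U and ?\<Gamma>2.0 = \<Gamma>2])
      show "path \<gamma> \<and> pathfinish \<gamma> = pathstart \<gamma> \<and> path_image \<gamma> \<subseteq> D" if "\<gamma> \<in> set \<Gamma>1" for \<gamma>
        using that "1.prems"(1)[OF mem] by (auto simp: \<Gamma>1_def valid_path_imp_path)
      show "path \<gamma> \<and> pathfinish \<gamma> = pathstart \<gamma> \<and> path_image \<gamma> \<subseteq> U - D" if "\<gamma> \<in> set \<Gamma>2" for \<gamma>
        using that "1.prems"(1)[OF mem] disj by (auto simp: valid_path_imp_path)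
      show "(\<Sum>\<gamma>\<leftarrow>\<Gamma>1. winding_number \<gamma> z) + (\<Sum>\<gamma>\<leftarrow>\<Gamma>2. winding_number \<gamma> z) = 0" if "z \<notin> U" for z
        using "1.prems"(2)[OF that] split by metis
    qed (use that D clD a in auto)
    have int1: "(\<Sum>\<gamma>\<leftarrow>\<Gamma>1. contour_integral \<gamma> h) = 0"
    proof (rule Cauchy_theorem_cycle_connected[OF D(1,2)])
      show "valid_path \<gamma> \<and> pathfinish \<gamma> = pathstart \<gamma> \<and> path_image \<gamma> \<subseteq> D" if "\<gamma> \<in> set \<Gamma>1" for \<gamma>
        using that "1.prems"(1)[OF mem] by (auto simp: \<Gamma>1_def)
    qed (use h D wn1 holomorphic_on_subset in auto)
    have "\<gamma>0 \<in> set \<Gamma>1 \<or> \<gamma>0 \<in> set \<Gamma>2"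
      using Cons by (auto simp: \<Gamma>1_def \<Gamma>2_def)
    moreover have "\<gamma>0 \<notin> set \<Gamma>2"
      using disj[of \<gamma>0] a pathstart_in_path_image[of \<gamma>0] by (auto simp: a_def)
    ultimately have "\<not> \<not> path_image \<gamma>0 \<subseteq> D" by (auto simp: \<Gamma>1_def)
    then have "length \<Gamma>2 < length \<Gamma>"
      unfolding \<Gamma>2_def using Cons length_filter_le[of "\<lambda>\<gamma>. \<not> path_image \<gamma> \<subseteq> D" \<Gamma>'] by (simp add: less_Suc_eq_le)
    moreover have "(\<Sum>\<gamma>\<leftarrow>\<Gamma>2. winding_number \<gamma> z) = 0" if "z \<notin> U" for z
    proof -
      have "z \<notin> D" using D(3) that by blast
      then show ?thesis
        using "1.prems"(2)[OF that] split[of "\<lambda>\<gamma>. winding_number \<gamma> z"] wn1[of z] by simp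
    qed
    ultimately have "(\<Sum>\<gamma>\<leftarrow>\<Gamma>2. contour_integral \<gamma> h) = 0"
      using "1.IH" "1.prems"(1) mem by blast
    then show ?thesis using split int1 by simp
  qed simp
qed


section \<open>Taylor coefficients as integrals over a surrounding cycle\<close>

text \<open>Write f(z) = f(0) + z g(z) with g holomorphic on \<open>U\<close>. For n = 0 the first
  term contributes the winding sum 1 and Cauchy's theorem kills g. For larger n the term with f(0)
  has a primitive on the punctured plane, which leaves the integral of g with the index lowered by
  one.\<close>

lemma cycle_integral_eq_fps_nth:
  assumes U: "open U" "0 \<in> U" and f: "f holomorphic_on U" and \<Gamma>: "surrounds \<Gamma> {0} U"
  shows "(\<Sum>\<gamma>\<leftarrow>\<Gamma>. contour_integral \<gamma> (\<lambda>z. f z / z ^ Suc n)) =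
    2 * pi * \<i> * fps_nth (fps_expansion f 0) n"
  using f
proof (induction n arbitrary: f)
  case (0 f)
  let ?g = "\<lambda>z. if z = 0 then deriv f 0 else (f z - f 0) / z"
  have g: "?g holomorphic_on U"
    using pole_lemma_open[OF 0 U(1), of 0] by (simp only: diff_zero)
  have \<Gamma>': "valid_path \<gamma>" "pathfinish \<gamma> = pathstart \<gamma>" "path_image \<gamma> \<subseteq> U" "0 \<notin> path_image \<gamma>" if "\<gamma> \<in> set \<Gamma>" for \<gamma>
    using \<Gamma> that by (auto simp: surrounds_def)
  have "contour_integral \<gamma> (\<lambda>z. f z / z ^ Suc 0) =
      f 0 * (2 * pi * \<i> * winding_number \<gamma> 0) + contour_integral \<gamma> ?g" if \<gamma>: "\<gamma> \<in> set \<Gamma>" for \<gamma>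
  proof -
    have "((\<lambda>z. 1 / (z - 0)) has_contour_integral 2 * pi * \<i> * winding_number \<gamma> 0) \<gamma>"
      using has_contour_integral_winding_number \<Gamma>'[OF \<gamma>] by blast
    then have "((\<lambda>z. f 0 * (1 / (z - 0))) has_contour_integral f 0 * (2 * pi * \<i> * winding_number \<gamma> 0)) \<gamma>"
      by (rule has_contour_integral_lmul)
    moreover have "(?g has_contour_integral contour_integral \<gamma> ?g) \<gamma>"
      using contour_integrable_holomorphic_simple[OF g U(1)] \<Gamma>'[OF \<gamma>] has_contour_integral_integral by blast
    ultimately have "((\<lambda>z. f 0 * (1 / (z - 0)) + ?g z) has_contour_integral
        f 0 * (2 * pi * \<i> * winding_number \<gamma> 0) + contour_integral \<gamma> ?g) \<gamma>"
      by (rule has_contour_integral_add)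
    then have "((\<lambda>z. f z / z ^ Suc 0) has_contour_integral
        f 0 * (2 * pi * \<i> * winding_number \<gamma> 0) + contour_integral \<gamma> ?g) \<gamma>"
      by (rule has_contour_integral_eq) (use \<Gamma>'(4)[OF \<gamma>] in \<open>auto simp: field_simps\<close>)
    then show ?thesis by (rule contour_integral_unique)
  qed
  then have "(\<Sum>\<gamma>\<leftarrow>\<Gamma>. contour_integral \<gamma> (\<lambda>z. f z / z ^ Suc 0)) =
      (\<Sum>\<gamma>\<leftarrow>\<Gamma>. f 0 * (2 * pi * \<i> * winding_number \<gamma> 0) + contour_integral \<gamma> ?g)"
    by (intro arg_cong[where f = sum_list] map_cong) auto
  also have "\<dots> = f 0 * (2 * pi * \<i>) * (\<Sum>\<gamma>\<leftarrow>\<Gamma>. winding_number \<gamma> 0) + (\<Sum>\<gamma>\<leftarrow>\<Gamma>. contour_integral \<gamma> ?g)"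
    by (simp add: sum_list_addf sum_list_const_mult[symmetric] mult.assoc)
  also have "(\<Sum>\<gamma>\<leftarrow>\<Gamma>. contour_integral \<gamma> ?g) = 0"
    by (rule Cauchy_theorem_cycle[OF U(1) g]) (use \<Gamma> in \<open>auto simp: surrounds_def\<close>)
  also have "(\<Sum>\<gamma>\<leftarrow>\<Gamma>. winding_number \<gamma> 0) = 1"
    using \<Gamma> by (simp add: surrounds_def)
  finally show ?case by (simp add: fps_expansion_def)
next
  case (Suc n f)
  let ?g = "\<lambda>z. if z = 0 then deriv f 0 else (f z - f 0) / z"
  have g: "?g holomorphic_on U"
    using pole_lemma_open[OF Suc.prems U(1), of 0] by (simp only: diff_zero)
  have "(\<lambda>z. f 0 + z * ?g z) has_fps_expansion fps_const (f 0) + fps_X * fps_expansion ?g 0"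
    using g U by (intro fps_expansion_intros has_fps_expansion_fps_expansion[of U]) auto
  also have "(\<lambda>z. f 0 + z * ?g z) = f" by auto
  finally have exp: "fps_expansion f 0 = fps_const (f 0) + fps_X * fps_expansion ?g 0"
    by (rule fps_expansion_eqI)
  have "contour_integral \<gamma> (\<lambda>z. f z / z ^ Suc (Suc n)) = contour_integral \<gamma> (\<lambda>z. ?g z / z ^ Suc n)"
    if "\<gamma> \<in> set \<Gamma>" for \<gamma>
  proof -
    have \<gamma>: "valid_path \<gamma>" "pathfinish \<gamma> = pathstart \<gamma>" "path_image \<gamma> \<subseteq> U - {0}" "0 \<notin> path_image \<gamma>"
      using \<Gamma> that by (auto simp: surrounds_def)
    \<comment> \<open>Chosen so that c z^-(n+1) is a primitive of f(0) / z^(n+2).\<close>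
    define c where "c = - f 0 / of_nat (Suc n)"
    have c: "of_nat (Suc n) * c = - f 0" unfolding c_def by (simp del: of_nat_Suc)
    have "((\<lambda>z. c * inverse z ^ Suc n) has_field_derivative f 0 / z ^ Suc (Suc n)) (at z)" if "z \<noteq> 0" for z
    proof (rule DERIV_cong[OF DERIV_cmult[OF DERIV_power[OF DERIV_inverse[OF that]]]])
      have "c * (of_nat (Suc n) * (- (inverse z ^ Suc (Suc 0)) * inverse z ^ (Suc n - Suc 0))) =
          - (of_nat (Suc n) * c) * inverse z ^ Suc (Suc n)"
        by (simp del: of_nat_Suc)
      then show "c * (of_nat (Suc n) * (- (inverse z ^ Suc (Suc 0)) * inverse z ^ (Suc n - Suc 0))) =
          f 0 / z ^ Suc (Suc n)"
        unfolding c by (simp only: minus_minus divide_inverse power_inverse)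
    qed
    then have "((\<lambda>z. f 0 / z ^ Suc (Suc n)) has_contour_integral 0) \<gamma>"
      by (intro Cauchy_theorem_primitive[where S = "- {0}"])
        (use \<gamma> in \<open>auto intro: has_field_derivative_at_within simp del: power_Suc\<close>)
    moreover have "(\<lambda>z. ?g z / z ^ Suc n) holomorphic_on U - {0}"
      by (intro holomorphic_intros holomorphic_on_subset[OF g]) auto
    then have "((\<lambda>z. ?g z / z ^ Suc n) has_contour_integral contour_integral \<gamma> (\<lambda>z. ?g z / z ^ Suc n)) \<gamma>"
      using contour_integrable_holomorphic_simple[of _ "U - {0}"] \<gamma> U(1) has_contour_integral_integral by blast
    ultimately have "((\<lambda>z. f 0 / z ^ Suc (Suc n) + ?g z / z ^ Suc n) has_contour_integral
        0 + contour_integral \<gamma> (\<lambda>z. ?g z / z ^ Suc n)) \<gamma>"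
      by (rule has_contour_integral_add)
    then have "((\<lambda>z. f z / z ^ Suc (Suc n)) has_contour_integral 0 + contour_integral \<gamma> (\<lambda>z. ?g z / z ^ Suc n)) \<gamma>"
      by (rule has_contour_integral_eq) (use \<gamma>(4) in \<open>auto simp: field_simps\<close>)
    then show ?thesis using contour_integral_unique by force
  qed
  then have "(\<Sum>\<gamma>\<leftarrow>\<Gamma>. contour_integral \<gamma> (\<lambda>z. f z / z ^ Suc (Suc n))) =
      (\<Sum>\<gamma>\<leftarrow>\<Gamma>. contour_integral \<gamma> (\<lambda>z. ?g z / z ^ Suc n))"
    by (intro arg_cong[where f = sum_list] map_cong) auto
  then show ?case
    using Suc.IH[OF g] by (simp add: exp)
qed

text \<open>A small circle about 0 suffices; this makes the choice by \<open>SOME\<close> in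
  \<open>riesz_dunford\<close> meaningful.\<close>

lemma surrounds_exists:
  assumes "open U" "0 \<in> U"
  shows "\<exists>\<Gamma>. surrounds \<Gamma> {0} U"
proof -
  obtain r where r: "r > 0" "cball 0 r \<subseteq> U"
    using assms open_contains_cball by blast
  have "path_image (circlepath 0 r) \<subseteq> U - {0}"
    using r by (auto simp: path_image_circlepath)
  moreover have "winding_number (circlepath 0 r) z = 0" if "z \<notin> U" for z
    by (rule winding_number_zero_outside[where s = "cball 0 r"])
      (use r that in \<open>auto simp: path_image_circlepath\<close>)
  moreover have "winding_number (circlepath 0 r) 0 = 1"
    using r by (intro winding_number_circlepath) auto
  ultimately have "surrounds [circlepath 0 r] {0} U"
    by (auto simp: surrounds_def)
  then show ?thesis by blast
qed

section \<open>Quasinilpotent operators and their resolvents\<close>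

lemma blinfun_eq_iff: "S = T \<longleftrightarrow> (\<forall>x. blinfun_apply S x = blinfun_apply T x)"
  by (auto intro: blinfun_eqI)

lemma scaleC_zero_left [simp]: "0 *\<^sub>C (x :: 'a::complex_inner) = 0"
  using scaleR_scaleC[of 0 x] by simp

lemma scaleC_diff_right: "c *\<^sub>C (x - y :: 'a::complex_inner) = c *\<^sub>C x - c *\<^sub>C y"
  using bounded_linear.linear[OF bounded_linear_scaleC] linear_diff by blast

lemma scaleC_minus_left: "(- c) *\<^sub>C (x :: 'a::complex_inner) = - (c *\<^sub>C x)"
  using scaleC_add_left[of "- c" c x] by (simp add: eq_neg_iff_add_eq_0)

lemma scaleC_diff_left: "(c - d) *\<^sub>C (x :: 'a::complex_inner) = c *\<^sub>C x - d *\<^sub>C x"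
  using scaleC_add_left[of c "- d" x] by (simp add: scaleC_minus_left)

lemma cinner_add_right: "cinner (x :: 'a::complex_inner) (y + z) = cinner x y + cinner x z"
  by (metis cinner_commute cinner_add_left complex_cnj_add)

lemma cinner_scaleC_right: "cinner (x :: 'a::complex_inner) (c *\<^sub>C y) = cnj c * cinner x y"
  by (metis cinner_commute cinner_scaleC_left complex_cnj_mult)

lemma cinner_self: "cinner x x = complex_of_real ((norm (x :: 'a::complex_inner))\<^sup>2)"
proof -
  have "Im (cinner x x) = 0"
    using cinner_commute[of x x] by (metis cnj.simps(2) neg_equal_0_iff_equal equal_neg_zero)
  moreover have "Re (cinner x x) = (norm x)\<^sup>2"
    by (simp add: norm_eq_sqrt_cinner cinner_nonneg)
  ultimately show ?thesis by (simp add: complex_eq_iff)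
qed

lemma norm_cinner_le: "norm (cinner x y) \<le> norm x * norm (y :: 'a::complex_inner)"
proof (cases "y = 0")
  case True
  then show ?thesis using cinner_scaleC_right[of x 0 0] by simp
next
  case False
  \<comment> \<open>With this \<open>c\<close> the vector x + c y is the component of
    \<open>x\<close> orthogonal to \<open>y\<close>.\<close>
  define c where "c = - cinner x y / (norm y)\<^sup>2"
  have n: "(norm y)\<^sup>2 > 0" using False by simp
  have "cinner (x + c *\<^sub>C y) (x + c *\<^sub>C y) =
      (norm x)\<^sup>2 + cnj c * cinner x y + c * cnj (cinner x y) + c * cnj c * (norm y)\<^sup>2"
    by (simp add: cinner_add_left cinner_add_right cinner_scaleC_left cinner_scaleC_right
        algebra_simps cinner_self[of x] cinner_self[of y] flip: cinner_commute[of y x])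
  also have "\<dots> = (norm x)\<^sup>2 - cinner x y * cnj (cinner x y) / (norm y)\<^sup>2"
    using n unfolding c_def by (simp add: field_simps power2_eq_square)
  also have "\<dots> = complex_of_real ((norm x)\<^sup>2 - (norm (cinner x y))\<^sup>2 / (norm y)\<^sup>2)"
    by (simp add: complex_norm_square flip: of_real_power)
  finally have "0 \<le> (norm x)\<^sup>2 - (norm (cinner x y))\<^sup>2 / (norm y)\<^sup>2"
    using cinner_nonneg[of "x + c *\<^sub>C y"] by (metis Re_complex_of_real)
  then have "(norm (cinner x y))\<^sup>2 \<le> (norm x * norm y)\<^sup>2"
    using n by (simp add: field_simps power_mult_distrib)
  then show ?thesis by (rule power2_le_imp_le) simp
qed

lemma bounded_linear_cinner_left: "bounded_linear (\<lambda>x :: 'a::complex_inner. cinner x y)"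
proof (rule bounded_linear_intro)
  show "cinner (x + z) y = cinner x y + cinner z y" for x z
    by (rule cinner_add_left)
  show "cinner (r *\<^sub>R x) y = r *\<^sub>R cinner x y" for r x
    by (simp add: scaleR_scaleC[of r x] cinner_scaleC_left scaleR_conv_of_real)
  show "norm (cinner x y) \<le> norm x * norm y" for x
    by (rule norm_cinner_le)
qed

section \<open>Complex multiples of bounded operators\<close>

text \<open>The operator type carries only real scalars. As a real bilinear map in both arguments,
  \<open>scale_op\<close> inherits the general rules on sums, limits and derivatives.\<close>

definition scale_op :: "complex \<Rightarrow> ('a::complex_hilbert \<Rightarrow>\<^sub>L 'a) \<Rightarrow> 'a \<Rightarrow>\<^sub>L 'a"
  where "scale_op c T = scalar_op c o\<^sub>L T"

lemma scale_op_apply [simp]: "blinfun_apply (scale_op c T) x = c *\<^sub>C blinfun_apply T x"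
  by (simp add: scale_op_def scalar_op.rep_eq)

lemma scalar_op_eq: "scalar_op c = scale_op c id_blinfun"
  by (rule blinfun_eqI) (simp add: scalar_op.rep_eq)

lemma norm_scale_op_le: "norm (scale_op c T) \<le> norm c * norm T"
  by (rule norm_blinfun_bound)
    (auto simp: norm_scaleC mult.assoc intro!: mult_left_mono norm_blinfun)

lemma bounded_bilinear_scale_op: "bounded_bilinear scale_op"
proof
  show "\<exists>K. \<forall>c T. norm (scale_op c T) \<le> norm c * norm T * K"
    using norm_scale_op_le by (intro exI[of _ 1]) auto
qed (auto intro!: blinfun_eqI simp: blinfun.add_left blinfun.scaleR_left scaleC_add_left scaleC_add_right
    scaleR_scaleC[where 'a = 'a] scaleC_scaleC scaleR_conv_of_real mult.commute)

interpretation scale_op: bounded_bilinear scale_op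
  by (rule bounded_bilinear_scale_op)

lemma scale_op_scale_op: "scale_op c (scale_op d T) = scale_op (c * d) T"
  by (rule blinfun_eqI) (simp add: scaleC_scaleC)

lemma scale_op_1 [simp]: "scale_op 1 T = T"
  by (rule blinfun_eqI) (simp add: scaleC_one)

lemma scale_op_compose_left: "scale_op c T o\<^sub>L S = scale_op c (T o\<^sub>L S)"
  by (rule blinfun_eqI) simp

lemma scale_op_compose_right: "complex_linear T \<Longrightarrow> T o\<^sub>L scale_op c S = scale_op c (T o\<^sub>L S)"
  by (rule blinfun_eqI) (simp add: complex_linear_def)

lemma complex_linear_id: "complex_linear id_blinfun"
  by (simp add: complex_linear_def)

lemma complex_linear_compose: "complex_linear S \<Longrightarrow> complex_linear T \<Longrightarrow> complex_linear (S o\<^sub>L T)"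
  by (simp add: complex_linear_def)

lemma complex_linear_scale_op: "complex_linear T \<Longrightarrow> complex_linear (scale_op c T)"
  by (simp add: complex_linear_def scaleC_scaleC mult.commute)

text \<open>Needed because \<open>is_inverse_op\<close> demands that the sum of the Neumann series
  be complex linear.\<close>

lemma complex_linear_sums:
  assumes "f sums S" "\<And>n. complex_linear (f n)"
  shows "complex_linear S"
  unfolding complex_linear_def
proof (intro allI)
  fix c x
  have *: "(\<lambda>n. blinfun_apply (f n) y) sums blinfun_apply S y" for y
    using bounded_linear.sums[OF blinfun.bounded_linear_left assms(1)] .
  have "(\<lambda>n. c *\<^sub>C blinfun_apply (f n) x) sums (c *\<^sub>C blinfun_apply S x)"
    using bounded_linear.sums[OF bounded_linear_scaleC *] .
  then show "blinfun_apply S (c *\<^sub>C x) = c *\<^sub>C blinfun_apply S x"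
    using *[of "c *\<^sub>C x"] assms(2) by (auto simp: complex_linear_def intro: sums_unique2)
qed

lemma compose_left_sums: "f sums S \<Longrightarrow> (\<lambda>n. T o\<^sub>L f n) sums (T o\<^sub>L S)"
  by (rule bounded_linear.sums[OF bounded_bilinear.bounded_linear_right[OF bounded_bilinear_blinfun_compose]])

lemma compose_right_sums: "f sums S \<Longrightarrow> (\<lambda>n. f n o\<^sub>L T) sums (S o\<^sub>L T)"
  by (rule bounded_linear.sums[OF bounded_bilinear.bounded_linear_left[OF bounded_bilinear_blinfun_compose]])

section \<open>Decay of the powers and the Neumann series\<close>

primrec op_pow :: "('a::complex_hilbert \<Rightarrow>\<^sub>L 'a) \<Rightarrow> nat \<Rightarrow> 'a \<Rightarrow>\<^sub>L 'a" where
  "op_pow A 0 = id_blinfun"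
| "op_pow A (Suc n) = A o\<^sub>L op_pow A n"

lemma op_pow_Suc_right: "op_pow A (Suc n) = op_pow A n o\<^sub>L A"
  by (induction n) (auto simp: blinfun_eq_iff)

lemma complex_linear_op_pow: "complex_linear A \<Longrightarrow> complex_linear (op_pow A n)"
  by (induction n) (auto intro: complex_linear_id complex_linear_compose)

text \<open>For nonzero \<open>z\<close>, I - zA is z times (1/z - A), and 1/z is not in the
  spectrum. The substitution moves the spectral point 0 to infinity, so no exceptional
  \<open>z\<close> is left.\<close>

lemma quasinilpotent_inverse_exists:
  assumes A: "complex_linear A" "quasinilpotent A"
  shows "\<exists>S. complex_linear S \<and> S o\<^sub>L (id_blinfun - scale_op z A) = id_blinfun \<and>
    (id_blinfun - scale_op z A) o\<^sub>L S = id_blinfun"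
proof (cases "z = 0")
  case True
  then show ?thesis
    by (intro exI[of _ id_blinfun]) (auto simp: complex_linear_id scale_op.zero_left blinfun_eq_iff)
next
  case False
  then have "1 / z \<notin> spectrum A"
    using A by (simp add: quasinilpotent_def)
  then obtain S where S: "complex_linear S" "S o\<^sub>L (scalar_op (1 / z) - A) = id_blinfun"
      "(scalar_op (1 / z) - A) o\<^sub>L S = id_blinfun"
    by (auto simp: spectrum_def is_inverse_op_def)
  have eq: "id_blinfun - scale_op z A = scale_op z (scalar_op (1 / z) - A)"
    using False by (simp add: scale_op.diff_right scalar_op_eq scale_op_scale_op)
  show ?thesis
  proof (intro exI[of _ "scale_op (1 / z) S"] conjI)
    show "complex_linear (scale_op (1 / z) S)" by (rule complex_linear_scale_op[OF S(1)])
    show "scale_op (1 / z) S o\<^sub>L (id_blinfun - scale_op z A) = id_blinfun"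
      using False S unfolding eq by (simp add: scale_op_compose_left scale_op_compose_right scale_op_scale_op)
    have "complex_linear (scalar_op (1 / z) - A)"
      using A(1) by (simp add: complex_linear_def blinfun.diff_left scaleC_diff_right scalar_op.rep_eq
          scaleC_scaleC mult.commute)
    then show "(id_blinfun - scale_op z A) o\<^sub>L scale_op (1 / z) S = id_blinfun"
      using False S unfolding eq by (simp add: scale_op_compose_left scale_op_compose_right scale_op_scale_op)
  qed
qed

text \<open>Let F(z) be the inverse of I - zA and M a bound of its norm on the circle of radius
  \<open>r\<close>. The entire function \<open>cinner (F z x) y\<close> has Taylor coefficients
  \<open>cinner (A^n x) y\<close>, which Cauchy's inequality bounds by M |x| |y| / r^n.\<close>

lemma quasinilpotent_power_bound:
  assumes A: "complex_linear A" "quasinilpotent A" and r: "r > 0"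
  shows "\<exists>M\<ge>0. \<forall>n. norm (op_pow A n) \<le> M / r ^ n"
proof -
  obtain F where lin: "\<And>z. complex_linear (F z)"
    and Fl: "\<And>z. F z o\<^sub>L (id_blinfun - scale_op z A) = id_blinfun"
    and Fr: "\<And>z. (id_blinfun - scale_op z A) o\<^sub>L F z = id_blinfun"
    using quasinilpotent_inverse_exists[OF A] by metis
  have Fl': "blinfun_apply (F z) (x - z *\<^sub>C blinfun_apply A x) = x" for z x
    using Fl[of z] by (auto simp: blinfun_eq_iff blinfun.diff_left)
  have Fr': "blinfun_apply (F z) x - z *\<^sub>C blinfun_apply A (blinfun_apply (F z) x) = x" for z x
    using Fr[of z] by (auto simp: blinfun_eq_iff blinfun.diff_left)
  \<comment> \<open>The resolvent identity in the variable 1/z; it yields continuity first and then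
    the derivative F(w) A F(w).\<close>
  have diff: "F z - F w = scale_op (z - w) (F z o\<^sub>L A o\<^sub>L F w)" for z w
  proof (rule blinfun_eqI)
    fix x
    let ?u = "blinfun_apply (F w) x"
    have "blinfun_apply (F z) x = blinfun_apply (F z) (?u - w *\<^sub>C blinfun_apply A ?u)"
      by (simp add: Fr')
    also have "?u - w *\<^sub>C blinfun_apply A ?u = (?u - z *\<^sub>C blinfun_apply A ?u) + (z - w) *\<^sub>C blinfun_apply A ?u"
      by (simp add: scaleC_diff_left)
    also have "blinfun_apply (F z) \<dots> = ?u + (z - w) *\<^sub>C blinfun_apply (F z) (blinfun_apply A ?u)"
      using lin[of z] by (simp add: blinfun.add_right Fl' complex_linear_def)
    finally show "blinfun_apply (F z - F w) x = blinfun_apply (scale_op (z - w) (F z o\<^sub>L A o\<^sub>L F w)) x"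
      by (simp add: blinfun.diff_left)
  qed
  have cont: "isCont F w" for w
  proof -
    define K where "K = norm A * norm (F w) + 1"
    have K: "K > 0" by (simp add: K_def add_nonneg_pos)
    have le: "norm (F z - F w) \<le> norm (z - w) * (norm (F z) * K)" for z
    proof -
      have "norm (F z - F w) \<le> norm (z - w) * norm (F z o\<^sub>L A o\<^sub>L F w)"
        unfolding diff by (rule norm_scale_op_le)
      also have "norm (F z o\<^sub>L A o\<^sub>L F w) \<le> norm (F z) * norm A * norm (F w)"
        by (meson mult_right_mono norm_blinfun_compose norm_ge_zero order_trans)
      also have "\<dots> \<le> norm (F z) * K"
        by (simp add: K_def algebra_simps)
      finally show ?thesis by (simp add: mult_left_mono)
    qed
    \<comment> \<open>The bound \<open>le\<close> still contains the unknown
      \<open>norm (F z)\<close>. At this distance it is absorbed: |F z| is at most |F w| + |F z| /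
      2.\<close>
    have "\<forall>\<^sub>F z in at w. norm (z - w) < 1 / (2 * K)"
      using K by (auto simp: eventually_at dist_norm intro!: exI[of _ "1 / (2 * K)"])
    then have "\<forall>\<^sub>F z in at w. norm (F z - F w) \<le> norm (z - w) * (2 * norm (F w) * K)"
    proof eventually_elim
      case (elim z)
      have "norm (F z) \<le> norm (F w) + norm (F z - F w)"
        by (metis add.commute norm_triangle_sub)
      also have "norm (F z - F w) \<le> (norm (z - w) * K) * norm (F z)"
        using le[of z] by (simp add: algebra_simps)
      also have "\<dots> \<le> 1 / 2 * norm (F z)"
        using elim K by (intro mult_right_mono) (auto simp: field_simps)
      finally have "norm (F z) \<le> 2 * norm (F w)" by simp
      then have "norm (z - w) * (norm (F z) * K) \<le> norm (z - w) * (2 * norm (F w) * K)"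
        using K by (intro mult_left_mono mult_right_mono) auto
      then show ?case using le[of z] by linarith
    qed
    moreover have "((\<lambda>z. norm (z - w) * (2 * norm (F w) * K)) \<longlongrightarrow> 0) (at w)"
      by (rule tendsto_eq_intros refl | simp)+
    ultimately have "((\<lambda>z. F z - F w) \<longlongrightarrow> 0) (at w)"
      by (rule Lim_null_comparison)
    then show ?thesis
      by (simp add: isCont_def LIM_zero_iff)
  qed
  have holo: "(\<lambda>z. cinner (blinfun_apply (F z) x) y) holomorphic_on UNIV" for x y
  proof -
    let ?\<phi> = "\<lambda>z. cinner (blinfun_apply (F z) x) y"
    have "(?\<phi> has_field_derivative
        cinner (blinfun_apply (F w) (blinfun_apply A (blinfun_apply (F w) x))) y) (at w)" for w
      unfolding has_field_derivative_iff
    proof (rule Lim_transform_eventually)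
      have "(F \<longlongrightarrow> F w) (at w)" using cont[of w] by (simp add: isCont_def)
      then show "((\<lambda>z. cinner (blinfun_apply (F z) (blinfun_apply A (blinfun_apply (F w) x))) y) \<longlongrightarrow>
          cinner (blinfun_apply (F w) (blinfun_apply A (blinfun_apply (F w) x))) y) (at w)"
        by (intro bounded_linear.tendsto[OF bounded_linear_cinner_left] blinfun.tendsto tendsto_const)
      have eq: "cinner (blinfun_apply (F z) (blinfun_apply A (blinfun_apply (F w) x))) y = (?\<phi> z - ?\<phi> w) / (z - w)"
        if "z \<noteq> w" for z
      proof -
        have "?\<phi> z - ?\<phi> w = cinner (blinfun_apply (F z - F w) x) y"
          by (simp add: blinfun.diff_left linear_diff[OF bounded_linear.linear[OF bounded_linear_cinner_left]])
        also have "\<dots> = (z - w) * cinner (blinfun_apply (F z) (blinfun_apply A (blinfun_apply (F w) x))) y"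
          by (simp add: diff cinner_scaleC_left)
        finally show ?thesis using that by simp
      qed
      show "\<forall>\<^sub>F z in at w. cinner (blinfun_apply (F z) (blinfun_apply A (blinfun_apply (F w) x))) y =
          (?\<phi> z - ?\<phi> w) / (z - w)"
        by (auto simp: eventually_at eq intro!: exI[of _ 1])
    qed
    then show ?thesis
      by (auto simp: holomorphic_on_def field_differentiable_def)
  qed
  \<comment> \<open>Since F(z) x = x + z F(z) A x, stripping the constant term replaces
    \<open>x\<close> by A x and lowers the index by one.\<close>
  have coeff: "fps_nth (fps_expansion (\<lambda>z. cinner (blinfun_apply (F z) x) y) 0) n = cinner (blinfun_apply (op_pow A n) x) y" for x y n
  proof (induction n arbitrary: x)
    case 0
    show ?case using Fl'[of 0] by (simp add: fps_expansion_def)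
  next
    case (Suc n)
    have "(\<lambda>z. cinner x y + z * cinner (blinfun_apply (F z) (blinfun_apply A x)) y) has_fps_expansion
      fps_const (cinner x y) + fps_X * fps_expansion (\<lambda>z. cinner (blinfun_apply (F z) (blinfun_apply A x)) y) 0"
      using holo by (intro fps_expansion_intros has_fps_expansion_fps_expansion[of UNIV]) auto
    also have "(\<lambda>z. cinner x y + z * cinner (blinfun_apply (F z) (blinfun_apply A x)) y) = (\<lambda>z. cinner (blinfun_apply (F z) x) y)"
    proof
      fix z
      have "blinfun_apply (F z) x = x + z *\<^sub>C blinfun_apply (F z) (blinfun_apply A x)"
        using Fl'[of z x] lin[of z] by (simp add: blinfun.diff_right complex_linear_def algebra_simps)
      then show "cinner x y + z * cinner (blinfun_apply (F z) (blinfun_apply A x)) y = cinner (blinfun_apply (F z) x) y"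
        by (simp add: cinner_add_left cinner_scaleC_left)
    qed
    finally show ?case
      using Suc[of "blinfun_apply A x"] op_pow_Suc_right[of A n] by (simp add: fps_expansion_eqI)
  qed
  have "compact (F ` sphere 0 r)"
    using cont by (intro compact_continuous_image compact_sphere continuous_at_imp_continuous_on) auto
  then obtain M where M: "\<And>z. z \<in> sphere 0 r \<Longrightarrow> norm (F z) \<le> M"
    using compact_imp_bounded bounded_iff by (metis imageI)
  have "complex_of_real r \<in> sphere 0 r" using r by simp
  then have "M \<ge> 0" using M norm_ge_zero order_trans by blast
  moreover have "norm (op_pow A n) \<le> M / r ^ n" for n
  proof (rule norm_blinfun_bound)
    show "0 \<le> M / r ^ n" using \<open>M \<ge> 0\<close> r by simp
    fix x
    \<comment> \<open>Testing against A^n x itself makes the coefficient the square of its norm; one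
      factor cancels at the end.\<close>
    let ?y = "blinfun_apply (op_pow A n) x"
    let ?\<phi> = "\<lambda>z. cinner (blinfun_apply (F z) x) ?y"
    have "norm ((deriv ^^ n) ?\<phi> 0) \<le> fact n * (M * norm x * norm ?y) / r ^ n"
    proof (rule Cauchy_inequality)
      show "?\<phi> holomorphic_on ball 0 r" "continuous_on (cball 0 r) ?\<phi>"
        using holo[of x ?y] holomorphic_on_imp_continuous_on holomorphic_on_subset by blast+
      fix z :: complex assume "norm (0 - z) = r"
      then have z: "z \<in> sphere 0 r" by simp
      have "norm (?\<phi> z) \<le> norm (blinfun_apply (F z) x) * norm ?y" by (rule norm_cinner_le)
      also have "\<dots> \<le> (norm (F z) * norm x) * norm ?y"
        by (intro mult_right_mono norm_blinfun) auto
      also have "\<dots> \<le> M * norm x * norm ?y"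
        using M[OF z] by (intro mult_right_mono) auto
      finally show "norm (?\<phi> z) \<le> M * norm x * norm ?y" .
    qed (use r in auto)
    moreover have "(deriv ^^ n) ?\<phi> 0 = fact n * (norm ?y)\<^sup>2"
      using coeff[of x ?y n] by (simp add: fps_expansion_def cinner_self field_simps)
    ultimately have "(norm ?y)\<^sup>2 \<le> M * norm x * norm ?y / r ^ n"
      using r by (simp add: norm_mult norm_power field_simps)
    then show "norm ?y \<le> M / r ^ n * norm x"
      by (cases "?y = 0") (use \<open>M \<ge> 0\<close> r in \<open>auto simp: power2_eq_square field_simps\<close>)
  qed
  ultimately show ?thesis by blast
qed

lemma quasinilpotent_summable:
  assumes A: "complex_linear A" "quasinilpotent A" and r: "r \<ge> 0"
  shows "summable (\<lambda>n. r ^ n * norm (op_pow A n))"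
proof -
  \<comment> \<open>The radius 2r + 1 gives ratio r / (2r + 1) below 1/2 and stays positive for r =
    0.\<close>
  obtain M where M: "M \<ge> 0" "\<And>n. norm (op_pow A n) \<le> M / (2 * r + 1) ^ n"
    using quasinilpotent_power_bound[OF A, of "2 * r + 1"] r by auto
  have "summable (\<lambda>n. M * (r / (2 * r + 1)) ^ n)"
    using r by (intro summable_mult summable_geometric) (auto simp: field_simps)
  moreover have "norm (r ^ n * norm (op_pow A n)) \<le> M * (r / (2 * r + 1)) ^ n" for n
    using mult_left_mono[OF M(2)[of n], of "r ^ n"] r by (simp add: power_divide mult.commute)
  ultimately show ?thesis
    by (rule summable_comparison_test')
qed

lemma is_inverse_op_unique:
  assumes "is_inverse_op T S" "is_inverse_op T S'"
  shows "S = S'"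
proof -
  have "S = S o\<^sub>L (T o\<^sub>L S')" using assms(2) by (simp add: is_inverse_op_def blinfun_eq_iff)
  also have "\<dots> = (S o\<^sub>L T) o\<^sub>L S'" by (simp add: blinfun_eq_iff)
  also have "\<dots> = S'" using assms(1) by (simp add: is_inverse_op_def blinfun_eq_iff)
  finally show ?thesis .
qed

text \<open>Neumann series: composing with z - A on either side telescopes to the identity, since
  the remainder A^n / z^n tends to 0. Inverses being unique, the sum is the operator selected by
  \<open>THE\<close>.\<close>

lemma resolvent_sums:
  assumes A: "complex_linear A" "quasinilpotent A" and z: "z \<noteq> 0"
  shows "(\<lambda>n. scale_op (1 / z ^ Suc n) (op_pow A n)) sums resolvent A z"
proof -
  have "summable (\<lambda>n. norm (1 / z) * ((1 / norm z) ^ n * norm (op_pow A n)))"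
    by (intro summable_mult quasinilpotent_summable[OF A]) auto
  then have sm: "summable (\<lambda>n. scale_op (1 / z ^ Suc n) (op_pow A n))"
    by (rule summable_comparison_test')
      (use norm_scale_op_le in \<open>auto simp: norm_divide norm_mult norm_power power_divide mult.assoc
        intro!: order.trans[OF norm_scale_op_le]\<close>)
  then obtain S where S: "(\<lambda>n. scale_op (1 / z ^ Suc n) (op_pow A n)) sums S"
    by (auto simp: summable_def)
  have "(\<lambda>n. (1 / norm z) ^ n * norm (op_pow A n)) \<longlonglongrightarrow> 0"
    by (intro summable_LIMSEQ_zero quasinilpotent_summable[OF A]) auto
  then have lim: "(\<lambda>n. scale_op (1 / z ^ n) (op_pow A n)) \<longlonglongrightarrow> 0"
    by (rule Lim_null_comparison[rotated])
      (auto simp: norm_divide norm_power power_divide intro!: always_eventually order.trans[OF norm_scale_op_le])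
  let ?g = "\<lambda>n. scale_op (1 / z ^ n) (op_pow A n) - scale_op (1 / z ^ Suc n) (op_pow A (Suc n))"
  have tel: "?g sums id_blinfun"
    using telescope_sums'[OF lim] by simp
  have lin: "complex_linear (op_pow A n)" for n
    by (rule complex_linear_op_pow[OF A(1)])
  have eq: "(\<lambda>n. (scalar_op z - A) o\<^sub>L scale_op (1 / z ^ Suc n) (op_pow A n)) = ?g"
    using z A(1) by (auto simp: blinfun_eq_iff blinfun.diff_left scalar_op.rep_eq scaleC_scaleC complex_linear_def)
  have left: "(scalar_op z - A) o\<^sub>L S = id_blinfun"
    using sums_unique2[OF compose_left_sums[OF S, of "scalar_op z - A", unfolded eq] tel] .
  have eq': "(\<lambda>n. scale_op (1 / z ^ Suc n) (op_pow A n) o\<^sub>L (scalar_op z - A)) = ?g"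
  proof (rule ext, rule blinfun_eqI)
    fix n x
    have "blinfun_apply (op_pow A n) (z *\<^sub>C x) = z *\<^sub>C blinfun_apply (op_pow A n) x"
      using lin by (simp add: complex_linear_def)
    then show "blinfun_apply (scale_op (1 / z ^ Suc n) (op_pow A n) o\<^sub>L (scalar_op z - A)) x = blinfun_apply (?g n) x"
      using z by (simp add: blinfun.diff_left blinfun.diff_right scalar_op.rep_eq scaleC_scaleC scaleC_diff_right
        op_pow_Suc_right del: op_pow.simps)
  qed
  moreover have "S o\<^sub>L (scalar_op z - A) = id_blinfun"
    using sums_unique2[OF compose_right_sums[OF S, of "scalar_op z - A", unfolded eq'] tel] .
  moreover have "complex_linear S"
    using S lin by (auto intro: complex_linear_sums complex_linear_scale_op)
  ultimately have "is_inverse_op (scalar_op z - A) S"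
    by (simp add: is_inverse_op_def left)
  then have "resolvent A z = S"
    unfolding resolvent_def using is_inverse_op_unique by blast
  then show ?thesis using S by simp
qed

section \<open>Termwise integration of the resolvent series\<close>

lemma norm_sums_diff_le:
  fixes f :: "nat \<Rightarrow> 'a::banach"
  assumes f: "f sums s" and le: "\<And>i. norm (f i) \<le> b i" and b: "summable b"
  shows "norm (sum f {..<n} - s) \<le> suminf b - sum b {..<n}"
proof -
  have sb: "summable (\<lambda>i. b (i + n))" using b by (simp add: summable_iff_shift)
  have "(\<lambda>i. f (i + n)) sums (s - sum f {..<n})"
    using f by (simp add: sums_iff_shift)
  then have "norm (s - sum f {..<n}) \<le> (\<Sum>i. b (i + n))"
    using sb le by (metis norm_suminf_le sums_unique)
  also have "\<dots> = suminf b - sum b {..<n}"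
    by (rule suminf_minus_initial_segment[OF b])
  finally show ?thesis by (simp add: norm_minus_commute)
qed

text \<open>Near a nonzero point each Neumann term has a scalar primitive. The differentiated series
  converges uniformly there, so the series of primitives may be differentiated term by term and sums
  to a primitive of f(z) times the resolvent.\<close>

lemma resolvent_local_primitive:
  assumes A: "complex_linear A" "quasinilpotent A"
    and z0: "z0 \<noteq> 0" and U: "open U" "z0 \<in> U" and f: "f holomorphic_on U"
  obtains \<epsilon> p P where "\<epsilon> > 0"
    "\<And>n z. z \<in> ball z0 \<epsilon> \<Longrightarrow> (p n has_field_derivative f z / z ^ Suc n) (at z)"
    "\<And>z. z \<in> ball z0 \<epsilon> \<Longrightarrow> (\<lambda>n. scale_op (p n z) (op_pow A n)) sums P z"
    "\<And>z. z \<in> ball z0 \<epsilon> \<Longrightarrow> (P has_derivative (\<lambda>h. scale_op (h * f z) (resolvent A z))) (at z)"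
proof -
  obtain e where e: "e > 0" "cball z0 e \<subseteq> U" using U open_contains_cball by blast
  \<comment> \<open>Keeps the ball where \<open>f\<close> is bounded and at distance at least
    \<open>\<delta>\<close> from 0.\<close>
  define \<epsilon> where "\<epsilon> = min e (norm z0 / 2)"
  define \<delta> where "\<delta> = norm z0 / 2"
  have pos: "\<epsilon> > 0" "\<delta> > 0" using e z0 by (auto simp: \<epsilon>_def \<delta>_def)
  let ?B = "ball z0 \<epsilon>"
  have sub: "?B \<subseteq> U" "?B \<subseteq> cball z0 e" using e by (auto simp: \<epsilon>_def)
  have far: "norm z \<ge> \<delta>" if "z \<in> ?B" for z
  proof -
    have "norm (z0 - z) < norm z0 / 2" using that by (simp add: dist_norm \<epsilon>_def)
    then show ?thesis using norm_triangle_sub[of z0 z] by (simp add: \<delta>_def)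
  qed
  have "compact (f ` cball z0 e)"
    using continuous_on_subset[OF holomorphic_on_imp_continuous_on[OF f] e(2)]
    by (intro compact_continuous_image) auto
  then obtain C where C: "\<And>z. z \<in> cball z0 e \<Longrightarrow> norm (f z) \<le> C"
    using compact_imp_bounded[of "f ` cball z0 e"] unfolding bounded_iff by blast
  have "C \<ge> 0" using order_trans[OF norm_ge_zero C[of z0]] e by simp
  have nz: "z \<noteq> 0" if "z \<in> ?B" for z using far[OF that] pos by auto
  have "\<exists>p. (\<forall>z\<in>?B. (p has_field_derivative f z / z ^ Suc n) (at z)) \<and> p z0 = 0" for n
  proof -
    have "(\<lambda>z. f z / z ^ Suc n) holomorphic_on ?B"
      by (intro holomorphic_intros holomorphic_on_subset[OF f sub(1)]) (use nz in auto)
    then obtain g where g: "\<And>z. z \<in> ?B \<Longrightarrow> (g has_field_derivative f z / z ^ Suc n) (at z within ?B)"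
      using holomorphic_convex_primitive'[OF convex_ball open_ball] by blast
    \<comment> \<open>Normalised to vanish at \<open>z0\<close>: differentiating the series requires
      convergence at one point, here the zero series.\<close>
    have "((\<lambda>z. g z - g z0) has_field_derivative f z / z ^ Suc n) (at z)" if "z \<in> ?B" for z
      using g[OF that] that by (auto intro!: derivative_eq_intros simp: at_within_open[OF that open_ball])
    then show ?thesis by (intro exI[of _ "\<lambda>z. g z - g z0"]) auto
  qed
  then obtain p where p: "\<And>n z. z \<in> ?B \<Longrightarrow> (p n has_field_derivative f z / z ^ Suc n) (at z)"
    and p0: "\<And>n. p n z0 = 0" by metis
  let ?f' = "\<lambda>n z h. scale_op (f z / z ^ Suc n * h) (op_pow A n)"
  let ?g' = "\<lambda>z h. scale_op (h * f z) (resolvent A z)"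
  define b where "b n = C / \<delta> ^ Suc n * norm (op_pow A n)" for n
  have sb: "summable b"
  proof -
    have "summable (\<lambda>n. C / \<delta> * ((1 / \<delta>) ^ n * norm (op_pow A n)))"
      using pos by (intro summable_mult quasinilpotent_summable[OF A]) auto
    then show ?thesis by (simp add: b_def[abs_def] power_divide mult.assoc)
  qed
  have tail: "norm ((\<Sum>i<n. ?f' i z h) - ?g' z h) \<le> (suminf b - sum b {..<n}) * norm h" if z: "z \<in> ?B" for z h n
  proof -
    have "(\<lambda>n. scale_op (h * f z) (scale_op (1 / z ^ Suc n) (op_pow A n))) sums ?g' z h"
      by (rule bounded_linear.sums[OF scale_op.bounded_linear_right resolvent_sums[OF A nz[OF z]]])
    then have s: "(\<lambda>n. ?f' n z h) sums ?g' z h"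
      by (simp add: scale_op_scale_op mult.commute)
    have "norm (?f' n z h) \<le> norm h * b n" for n
    proof -
      have "norm (?f' n z h) \<le> norm (f z / z ^ Suc n * h) * norm (op_pow A n)"
        by (rule norm_scale_op_le)
      also have "norm (f z / z ^ Suc n * h) \<le> C / \<delta> ^ Suc n * norm h"
        unfolding norm_mult norm_divide norm_power
        using C[of z] z sub far[OF z] pos \<open>C \<ge> 0\<close>
        by (intro mult_right_mono frac_le power_mono) (auto intro!: mult_pos_pos)
      finally show ?thesis by (simp add: b_def mult_right_mono algebra_simps)
    qed
    then have "norm ((\<Sum>i<n. ?f' i z h) - ?g' z h) \<le> (\<Sum>n. norm h * b n) - (\<Sum>i<n. norm h * b i)"
      by (intro norm_sums_diff_le[OF s] summable_mult sb)
    also have "\<dots> = (suminf b - sum b {..<n}) * norm h"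
      by (simp add: suminf_mult[OF sb] sum_distrib_left[symmetric] algebra_simps)
    finally show ?thesis .
  qed
  have "\<exists>P. \<forall>z\<in>?B. (\<lambda>n. scale_op (p n z) (op_pow A n)) sums P z \<and> (P has_derivative ?g' z) (at z within ?B)"
  proof (rule has_derivative_series[where f' = ?f' and l = 0 and x = z0])
    show "((\<lambda>z. scale_op (p n z) (op_pow A n)) has_derivative ?f' n z) (at z within ?B)" if "z \<in> ?B" for n z
      using bounded_linear.has_derivative[OF scale_op.bounded_linear_left p[OF that, of n, unfolded has_field_derivative_def]]
        has_derivative_at_withinI by blast
    show "\<forall>\<^sub>F n in sequentially. \<forall>z\<in>?B. \<forall>h. norm ((\<Sum>i<n. ?f' i z h) - ?g' z h) \<le> e * norm h" if "e > 0" for e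
    proof -
      have "(\<lambda>n. suminf b - sum b {..<n}) \<longlonglongrightarrow> suminf b - suminf b"
        by (intro tendsto_diff tendsto_const summable_LIMSEQ sb)
      then have "\<forall>\<^sub>F n in sequentially. suminf b - sum b {..<n} < e"
        using that order_tendstoD(2) by fastforce
      then show ?thesis
      proof eventually_elim
        case (elim n)
        show ?case
        proof (intro ballI allI)
          fix z h assume "z \<in> ?B"
          then show "norm ((\<Sum>i<n. ?f' i z h) - ?g' z h) \<le> e * norm h"
            using order_trans[OF tail mult_right_mono[of "suminf b - sum b {..<n}" e "norm h"]] elim by force
        qed
      qed
    qed
    show "(\<lambda>n. scale_op (p n z0) (op_pow A n)) sums 0"
      by (simp add: p0 scale_op.zero_left)
  qed (use pos in auto)
  then obtain P where P: "\<And>z. z \<in> ?B \<Longrightarrow> (\<lambda>n. scale_op (p n z) (op_pow A n)) sums P z"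
    "\<And>z. z \<in> ?B \<Longrightarrow> (P has_derivative ?g' z) (at z within ?B)"
    by blast
  then have "(P has_derivative ?g' z) (at z)" if "z \<in> ?B" for z
    using P(2)[OF that] at_within_open[OF that open_ball] by simp
  then show thesis using that pos(1) p P(1) by blast
qed

text \<open>
  The derivative of a valid path may be unbounded near its finitely many exceptional points, so the
  series cannot be integrated termwise by uniform convergence; instead both sides are computed
  locally from primitives.
\<close>

lemma resolvent_integral_sums:
  assumes A: "complex_linear A" "quasinilpotent A"
    and U: "open U" and f: "f holomorphic_on U"
    and \<gamma>: "valid_path \<gamma>" "path_image \<gamma> \<subseteq> U - {0}"
  shows "(\<lambda>n. scale_op (contour_integral \<gamma> (\<lambda>z. f z / z ^ Suc n)) (op_pow A n)) sums resolvent_integral f A \<gamma>"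
proof -
  define vd where "vd t = vector_derivative \<gamma> (at t within {0..1})" for t
  define s where "s n t = f (\<gamma> t) / \<gamma> t ^ Suc n * vd t" for n t
  define G where "G t = scale_op (f (\<gamma> t) * vd t) (resolvent A (\<gamma> t))" for t
  \<comment> \<open>The property for a bisection argument: it passes to adjacent intervals and holds
    on short ones. The guard is there because the short intervals around a point may stick out of
    [0, 1].\<close>
  define P where "P u v \<longleftrightarrow> (0 \<le> u \<and> v \<le> 1 \<longrightarrow> (\<exists>J S. (\<forall>n. (s n has_integral J n) {u..v}) \<and>
      (\<lambda>n. scale_op (J n) (op_pow A n)) sums S \<and> (G has_integral S) {u..v}))" for u v
  have cont: "continuous_on {0..1} \<gamma>"
    using \<gamma>(1) valid_path_imp_path path_def by blast
  obtain K where "finite K" "\<gamma> C1_differentiable_on ({0..1} - K)"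
    using \<gamma>(1) by (auto simp: valid_path_def piecewise_C1_differentiable_on_def)
  then have vd: "(\<gamma> has_vector_derivative vd t) (at t)" if t: "t \<in> {0..1} - K" for t
  proof -
    obtain D where D: "(\<gamma> has_vector_derivative D) (at t)"
      using t \<open>\<gamma> C1_differentiable_on _\<close> unfolding C1_differentiable_on_def by blast
    then have "vd t = D"
      unfolding vd_def using t by (intro vector_derivative_at_within_ivl) auto
    then show ?thesis using D by simp
  qed
  have "P 0 1"
  proof (rule Bolzano)
    fix a b c assume P: "P a b" "P b c" and le: "a \<le> b" "b \<le> c"
    show "P a c"
      unfolding P_def
    proof (intro impI)
      assume "0 \<le> a \<and> c \<le> 1"
      then have "0 \<le> a \<and> b \<le> 1" "0 \<le> b \<and> c \<le> 1" using le by auto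
      then obtain J S J' S' where J: "\<And>n. (s n has_integral J n) {a..b}"
          "(\<lambda>n. scale_op (J n) (op_pow A n)) sums S" "(G has_integral S) {a..b}"
        and J': "\<And>n. (s n has_integral J' n) {b..c}"
          "(\<lambda>n. scale_op (J' n) (op_pow A n)) sums S'" "(G has_integral S') {b..c}"
        using P unfolding P_def by blast
      show "\<exists>J S. (\<forall>n. (s n has_integral J n) {a..c}) \<and>
          (\<lambda>n. scale_op (J n) (op_pow A n)) sums S \<and> (G has_integral S) {a..c}"
        using has_integral_combine[OF le J(1) J'(1)] has_integral_combine[OF le J(3) J'(3)]
          sums_add[OF J(2) J'(2)]
        by (intro exI[of _ "\<lambda>n. J n + J' n"] exI[of _ "S + S'"]) (simp add: scale_op.add_left)
    qed
  next
    fix x :: real assume x: "0 \<le> x" "x \<le> 1"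
    then have "\<gamma> x \<in> path_image \<gamma>" by (auto simp: path_image_def)
    then have "\<gamma> x \<noteq> 0" "\<gamma> x \<in> U" using \<gamma>(2) by auto
    then obtain \<epsilon> p Q where "\<epsilon> > 0"
      and p: "\<And>n z. z \<in> ball (\<gamma> x) \<epsilon> \<Longrightarrow> (p n has_field_derivative f z / z ^ Suc n) (at z)"
      and sums: "\<And>z. z \<in> ball (\<gamma> x) \<epsilon> \<Longrightarrow> (\<lambda>n. scale_op (p n z) (op_pow A n)) sums Q z"
      and Q: "\<And>z. z \<in> ball (\<gamma> x) \<epsilon> \<Longrightarrow> (Q has_derivative (\<lambda>h. scale_op (h * f z) (resolvent A z))) (at z)"
      using resolvent_local_primitive[OF A _ U _ f] by blast
    then obtain d where "d > 0" and "\<forall>t\<in>{0..1}. dist t x < d \<longrightarrow> dist (\<gamma> t) (\<gamma> x) < \<epsilon>"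
      using cont x unfolding continuous_on_iff by (meson atLeastAtMost_iff)
    then have d: "\<gamma> t \<in> ball (\<gamma> x) \<epsilon>" if "t \<in> {0..1}" "dist t x < d" for t
      using that by (simp add: dist_commute)
    have "P u v" if uv: "u \<le> x \<and> x \<le> v \<and> v - u < d" for u v
      unfolding P_def
    proof (intro impI exI conjI allI)
      assume 01: "0 \<le> u \<and> v \<le> 1"
      have le: "u \<le> v" using uv by simp
      have ball: "\<gamma> t \<in> ball (\<gamma> x) \<epsilon>" if "t \<in> {u..v}" for t
        using d[of t] that uv 01 by (auto simp: dist_real_def)
      have c: "continuous_on {u..v} \<gamma>"
        using cont 01 by (rule_tac continuous_on_subset) auto
      have der: "(\<gamma> has_vector_derivative vd t) (at t)" if "t \<in> {u<..<v} - K" for t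
        using vd that 01 by auto
      \<comment> \<open>This form of the fundamental theorem asks only for continuity at the
        finitely many points of \<open>K\<close>.\<close>
      show "(s n has_integral ((p n \<circ> \<gamma>) v - (p n \<circ> \<gamma>) u)) {u..v}" for n
      proof (rule fundamental_theorem_of_calculus_interior_strong[OF \<open>finite K\<close> le])
        fix t assume t: "t \<in> {u<..<v} - K"
        then show "(p n \<circ> \<gamma> has_vector_derivative s n t) (at t)"
          using field_vector_diff_chain_at[OF der[OF t] p[OF ball, of t n]] by (simp add: s_def mult.commute)
      next
        have "continuous_on (ball (\<gamma> x) \<epsilon>) (p n)"
          using p DERIV_isCont continuous_at_imp_continuous_on by blast
        then show "continuous_on {u..v} (p n \<circ> \<gamma>)"
          using ball by (intro continuous_on_compose c) (auto elim: continuous_on_subset)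
      qed
      show "(G has_integral ((Q \<circ> \<gamma>) v - (Q \<circ> \<gamma>) u)) {u..v}"
      proof (rule fundamental_theorem_of_calculus_interior_strong[OF \<open>finite K\<close> le])
        fix t assume t: "t \<in> {u<..<v} - K"
        have "(Q \<circ> \<gamma> has_derivative (\<lambda>h. scale_op (h * f (\<gamma> t)) (resolvent A (\<gamma> t))) \<circ> (\<lambda>h. h *\<^sub>R vd t)) (at t)"
          using t by (intro diff_chain_at Q ball der[OF t, unfolded has_vector_derivative_def]) auto
        also have "(\<lambda>h. scale_op (h * f (\<gamma> t)) (resolvent A (\<gamma> t))) \<circ> (\<lambda>h. h *\<^sub>R vd t) = (\<lambda>h. h *\<^sub>R G t)"
          by (auto simp: G_def fun_eq_iff mult.commute simp flip: scale_op.scaleR_left)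
        finally show "(Q \<circ> \<gamma> has_vector_derivative G t) (at t)"
          unfolding has_vector_derivative_def .
      next
        have "continuous_on (ball (\<gamma> x) \<epsilon>) Q"
          using Q has_derivative_continuous continuous_at_imp_continuous_on by blast
        then show "continuous_on {u..v} (Q \<circ> \<gamma>)"
          using ball by (intro continuous_on_compose c) (auto elim: continuous_on_subset)
      qed
      show "(\<lambda>n. scale_op ((p n \<circ> \<gamma>) v - (p n \<circ> \<gamma>) u) (op_pow A n)) sums ((Q \<circ> \<gamma>) v - (Q \<circ> \<gamma>) u)"
        using sums_diff[OF sums[OF ball[of v]] sums[OF ball[of u]]] le by (simp add: scale_op.diff_left)
    qed
    then show "\<exists>d>0. \<forall>a b. a \<le> x \<and> x \<le> b \<and> b - a < d \<longrightarrow> P a b"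
      using \<open>d > 0\<close> by blast
  qed simp
  then obtain J S where J: "\<And>n. (s n has_integral J n) {0..1}"
      "(\<lambda>n. scale_op (J n) (op_pow A n)) sums S" "(G has_integral S) {0..1}"
    by (auto simp: P_def)
  have "contour_integral \<gamma> (\<lambda>z. f z / z ^ Suc n) = J n" for n
    using J(1)[of n] unfolding s_def vd_def
    by (intro contour_integral_unique) (simp add: has_contour_integral_def)
  moreover have "resolvent_integral f A \<gamma> = S"
    using integral_unique[OF J(3)] unfolding resolvent_integral_def G_def vd_def scale_op_def .
  ultimately show ?thesis using J(2) by simp
qed

section \<open>The functional calculus as a power series\<close>

definition op_series :: "('a::complex_hilbert \<Rightarrow>\<^sub>L 'a) \<Rightarrow> (complex \<Rightarrow> complex) \<Rightarrow> 'a \<Rightarrow>\<^sub>L 'a"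
  where "op_series A \<phi> = (\<Sum>n. scale_op (fps_nth (fps_expansion \<phi> 0) n) (op_pow A n))"

lemma fps_expansion_ball:
  assumes "\<phi> holomorphic_on ball 0 R" "R > 0"
  shows "\<phi> has_fps_expansion fps_expansion \<phi> 0"
  using assms by (intro has_fps_expansion_fps_expansion[of "ball 0 R"]) auto

lemma norm_fps_nth_le:
  assumes \<phi>: "\<phi> holomorphic_on ball 0 R" and r: "0 < r" "r < R"
    and B: "\<And>z. z \<in> sphere 0 r \<Longrightarrow> norm (\<phi> z) \<le> B"
  shows "norm (fps_nth (fps_expansion \<phi> 0) n) \<le> B * (1 / r) ^ n"
proof -
  have "norm ((deriv ^^ n) \<phi> 0) \<le> fact n * B / r ^ n"
  proof (rule Cauchy_inequality)
    show "\<phi> holomorphic_on ball 0 r" "continuous_on (cball 0 r) \<phi>"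
      using r by (auto intro!: holomorphic_on_imp_continuous_on intro: holomorphic_on_subset[OF \<phi>])
  qed (use r B in auto)
  then show ?thesis
    by (simp add: fps_expansion_def norm_divide power_divide field_simps)
qed

lemma holomorphic_bounded_on_sphere:
  fixes \<phi> :: "complex \<Rightarrow> complex"
  assumes \<phi>: "\<phi> holomorphic_on ball 0 R" and r: "0 < r" "r < R"
  obtains B where "B \<ge> 0" "\<And>z. z \<in> sphere 0 r \<Longrightarrow> norm (\<phi> z) \<le> B"
proof -
  have "sphere 0 r \<subseteq> ball (0 :: complex) R" using r by auto
  then have "compact (\<phi> ` sphere 0 r)"
    using holomorphic_on_imp_continuous_on[OF holomorphic_on_subset[OF \<phi>]]
    by (intro compact_continuous_image) auto
  then obtain B where B: "\<And>z. z \<in> sphere 0 r \<Longrightarrow> norm (\<phi> z) \<le> B"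
    using compact_imp_bounded[of "\<phi> ` sphere 0 r"] unfolding bounded_iff by blast
  moreover have "B \<ge> 0"
    using order_trans[OF norm_ge_zero B[of "complex_of_real r"]] r by simp
  ultimately show ?thesis using that by blast
qed

context
  fixes A :: "'a::complex_hilbert \<Rightarrow>\<^sub>L 'a"
  assumes A: "complex_linear A" "quasinilpotent A"
begin

text \<open>Cauchy's estimates against the summable norms of the powers. The factor multiplying
  \<open>B\<close> depends only on \<open>A\<close> and \<open>r\<close>, so uniform smallness on
  one circle forces smallness in operator norm.\<close>

lemma op_series_bound:
  assumes \<phi>: "\<phi> holomorphic_on ball 0 R" and r: "0 < r" "r < R"
    and B: "B \<ge> 0" "\<And>z. z \<in> sphere 0 r \<Longrightarrow> norm (\<phi> z) \<le> B"
  shows "(\<lambda>n. scale_op (fps_nth (fps_expansion \<phi> 0) n) (op_pow A n)) sums op_series A \<phi>"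
    and "norm (op_series A \<phi>) \<le> B * (\<Sum>n. (1 / r) ^ n * norm (op_pow A n))"
proof -
  let ?t = "\<lambda>n. scale_op (fps_nth (fps_expansion \<phi> 0) n) (op_pow A n)"
  have sm: "summable (\<lambda>n. (1 / r) ^ n * norm (op_pow A n))"
    using r by (intro quasinilpotent_summable[OF A]) auto
  have le: "norm (?t n) \<le> B * ((1 / r) ^ n * norm (op_pow A n))" for n
  proof -
    have "norm (?t n) \<le> norm (fps_nth (fps_expansion \<phi> 0) n) * norm (op_pow A n)"
      by (rule norm_scale_op_le)
    also have "\<dots> \<le> B * (1 / r) ^ n * norm (op_pow A n)"
      by (intro mult_right_mono norm_fps_nth_le[OF \<phi> r B(2)]) auto
    finally show ?thesis by (simp add: mult.assoc)
  qed
  have "summable ?t"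
    by (rule summable_comparison_test'[OF summable_mult[OF sm, of B]]) (rule le)
  then show "?t sums op_series A \<phi>"
    unfolding op_series_def by (rule summable_sums)
  have "norm (op_series A \<phi>) \<le> (\<Sum>n. B * ((1 / r) ^ n * norm (op_pow A n)))"
    unfolding op_series_def by (rule norm_suminf_le[OF le summable_mult[OF sm]])
  then show "norm (op_series A \<phi>) \<le> B * (\<Sum>n. (1 / r) ^ n * norm (op_pow A n))"
    by (simp add: suminf_mult[OF sm])
qed

lemma op_series_sums:
  assumes \<phi>: "\<phi> holomorphic_on ball 0 R" "R > 0"
  shows "(\<lambda>n. scale_op (fps_nth (fps_expansion \<phi> 0) n) (op_pow A n)) sums op_series A \<phi>"
proof -
  have r: "0 < R / 2" "R / 2 < R" using \<phi>(2) by auto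
  obtain B where "B \<ge> 0" "\<And>z. z \<in> sphere 0 (R / 2) \<Longrightarrow> norm (\<phi> z) \<le> B"
    using holomorphic_bounded_on_sphere[OF \<phi>(1) r] by blast
  then show ?thesis by (rule op_series_bound(1)[OF \<phi>(1) r])
qed

lemma op_series_diff:
  assumes "\<phi> holomorphic_on ball 0 R" "\<psi> holomorphic_on ball 0 R" "R > 0"
  shows "op_series A (\<lambda>z. \<phi> z - \<psi> z) = op_series A \<phi> - op_series A \<psi>"
proof -
  have "fps_expansion (\<lambda>z. \<phi> z - \<psi> z) 0 = fps_expansion \<phi> 0 - fps_expansion \<psi> 0"
    using assms fps_expansion_ball by (intro fps_expansion_eqI fps_expansion_intros) auto
  then show ?thesis
    using op_series_sums[of "\<lambda>z. \<phi> z - \<psi> z" R]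
      sums_diff[OF op_series_sums[OF assms(1,3)] op_series_sums[OF assms(2,3)]] assms
    by (auto simp: scale_op.diff_left intro: holomorphic_on_diff sums_unique2)
qed

lemma op_series_add:
  assumes "\<phi> holomorphic_on ball 0 R" "\<psi> holomorphic_on ball 0 R" "R > 0"
  shows "op_series A (\<lambda>z. \<phi> z + \<psi> z) = op_series A \<phi> + op_series A \<psi>"
  using op_series_diff[of "\<lambda>z. \<phi> z + \<psi> z" R \<psi>] assms by (simp add: holomorphic_on_add)

lemma op_series_cmult:
  assumes "\<phi> holomorphic_on ball 0 R" "R > 0"
  shows "op_series A (\<lambda>z. c * \<phi> z) = scale_op c (op_series A \<phi>)"
proof -
  have "fps_expansion (\<lambda>z. c * \<phi> z) 0 = fps_const c * fps_expansion \<phi> 0"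
    using assms fps_expansion_ball by (intro fps_expansion_eqI fps_expansion_intros) auto
  then show ?thesis
    using op_series_sums[OF holomorphic_on_mult[OF holomorphic_on_const assms(1)] assms(2), of c]
      bounded_linear.sums[OF scale_op.bounded_linear_right[of c] op_series_sums[OF assms]]
    by (simp add: scale_op_scale_op sums_unique2)
qed

lemma op_series_const: "op_series A (\<lambda>z. c) = scale_op c id_blinfun"
proof -
  have "fps_expansion (\<lambda>z. c) 0 = fps_const c"
    by (intro fps_expansion_eqI fps_expansion_intros)
  then have "op_series A (\<lambda>z. c) = (\<Sum>n. if n = 0 then scale_op c (op_pow A n) else 0)"
    unfolding op_series_def by (intro suminf_cong) (auto simp: scale_op.zero_left)
  then show ?thesis using sums_unique[OF sums_single[of 0 "\<lambda>n. scale_op c (op_pow A n)"]] by simp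
qed

text \<open>Multiplication by z shifts the coefficients by one, composition with \<open>A\<close>
  shifts the powers by one, and the new constant term is 0.\<close>

lemma op_series_mult_ident:
  assumes "\<phi> holomorphic_on ball 0 R" "R > 0"
  shows "op_series A (\<lambda>z. z * \<phi> z) = A o\<^sub>L op_series A \<phi>"
proof -
  have exp: "fps_expansion (\<lambda>z. z * \<phi> z) 0 = fps_X * fps_expansion \<phi> 0"
    using assms fps_expansion_ball by (intro fps_expansion_eqI fps_expansion_intros) auto
  have "(\<lambda>n. A o\<^sub>L scale_op (fps_nth (fps_expansion \<phi> 0) n) (op_pow A n)) sums (A o\<^sub>L op_series A \<phi>)"
    by (rule compose_left_sums[OF op_series_sums[OF assms]])
  then have "(\<lambda>n. scale_op (fps_nth (fps_expansion (\<lambda>z. z * \<phi> z) 0) (Suc n)) (op_pow A (Suc n))) sums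
      (A o\<^sub>L op_series A \<phi>)"
    by (simp add: exp scale_op_compose_right[OF A(1)])
  from sums_Suc[OF this] have "(\<lambda>n. scale_op (fps_nth (fps_expansion (\<lambda>z. z * \<phi> z) 0) n) (op_pow A n)) sums
      (A o\<^sub>L op_series A \<phi>)"
    by (simp add: exp scale_op.zero_left)
  then show ?thesis
    by (simp add: op_series_def sums_iff)
qed

lemma op_series_mult_power:
  assumes "\<phi> holomorphic_on ball 0 R" "R > 0"
  shows "op_series A (\<lambda>z. z ^ n * \<phi> z) = op_pow A n o\<^sub>L op_series A \<phi>"
proof (induction n)
  case 0
  show ?case by (simp add: blinfun_eq_iff)
next
  case (Suc n)
  have "op_series A (\<lambda>z. z * (z ^ n * \<phi> z)) = A o\<^sub>L (op_pow A n o\<^sub>L op_series A \<phi>)"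
    using assms by (subst op_series_mult_ident[of _ R]) (auto intro!: holomorphic_intros simp: Suc)
  then show ?case by (simp add: mult.assoc blinfun_eq_iff)
qed

lemma op_series_mult_poly:
  assumes "\<phi> holomorphic_on ball 0 R" "R > 0"
  shows "op_series A (\<lambda>z. (\<Sum>k<m. c k * z ^ k) * \<phi> z) = (\<Sum>k<m. scale_op (c k) (op_pow A k)) o\<^sub>L op_series A \<phi>"
proof (induction m)
  case 0
  show ?case using op_series_const[of 0] by (simp add: scale_op.zero_left)
next
  case (Suc m)
  have h: "(\<lambda>z. z ^ m * \<phi> z) holomorphic_on ball 0 R"
    using assms by (intro holomorphic_intros)
  have "op_series A (\<lambda>z. (\<Sum>k<Suc m. c k * z ^ k) * \<phi> z) =
      op_series A (\<lambda>z. (\<Sum>k<m. c k * z ^ k) * \<phi> z + c m * (z ^ m * \<phi> z))"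
    by (simp add: algebra_simps)
  also have "\<dots> = ((\<Sum>k<m. scale_op (c k) (op_pow A k)) o\<^sub>L op_series A \<phi>) + scale_op (c m) (op_pow A m o\<^sub>L op_series A \<phi>)"
    using assms by (subst op_series_add[of _ R])
      (auto intro!: holomorphic_intros simp: Suc op_series_cmult[OF h] op_series_mult_power[of _ R])
  finally show ?case by (simp add: blinfun_eq_iff blinfun.add_left)
qed

lemma op_series_tendsto:
  assumes \<phi>: "\<phi> holomorphic_on ball 0 R" "\<And>m. \<phi>m m holomorphic_on ball 0 R"
    and r: "0 < r" "r < R"
    and lim: "uniform_limit (sphere 0 r) \<phi>m \<phi> sequentially"
  shows "(\<lambda>m. op_series A (\<phi>m m)) \<longlonglongrightarrow> op_series A \<phi>"
proof (rule tendstoI)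
  fix e :: real assume e: "e > 0"
  define S where "S = (\<Sum>n. (1 / r) ^ n * norm (op_pow A n))"
  have "S \<ge> 0"
    unfolding S_def using r by (intro suminf_nonneg quasinilpotent_summable[OF A]) auto
  \<comment> \<open>The added 1 covers S = 0 and makes \<open>d * S < e\<close> strict.\<close>
  define d where "d = e / (S + 1)"
  have d: "d > 0" "d * S < e" using e \<open>S \<ge> 0\<close> by (auto simp: d_def field_simps)
  from lim d(1) have "\<forall>\<^sub>F m in sequentially. \<forall>z\<in>sphere 0 r. dist (\<phi>m m z) (\<phi> z) < d"
    by (rule uniform_limitD)
  then show "\<forall>\<^sub>F m in sequentially. dist (op_series A (\<phi>m m)) (op_series A \<phi>) < e"
  proof eventually_elim
    case (elim m)
    have "norm (op_series A (\<lambda>z. \<phi>m m z - \<phi> z)) \<le> d * S"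
      unfolding S_def
      by (rule op_series_bound(2)[of _ R]) (use \<phi> r d elim in \<open>auto simp: dist_norm intro!: holomorphic_intros less_imp_le\<close>)
    then show ?case
      using op_series_diff[of "\<phi>m m" R \<phi>] \<phi> r d by (simp add: dist_norm)
  qed
qed

lemma taylor_uniform_limit:
  assumes \<phi>: "\<phi> holomorphic_on ball 0 R" and r: "0 < r" "r < R"
  shows "uniform_limit (cball 0 r) (\<lambda>m z. \<Sum>k<m. fps_nth (fps_expansion \<phi> 0) k * z ^ k) \<phi> sequentially"
proof -
  \<comment> \<open>Coefficient bounds on a strictly larger circle give the geometric ratio r / r' <
    1 on the disc of radius \<open>r\<close>.\<close>
  define r' where "r' = (r + R) / 2"
  have r': "0 < r'" "r' < R" "r < r'" using r by (auto simp: r'_def)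
  obtain B where B: "\<And>z. z \<in> sphere 0 r' \<Longrightarrow> norm (\<phi> z) \<le> B"
    using holomorphic_bounded_on_sphere[OF \<phi> r'(1,2)] by blast
  have "uniform_limit (cball 0 r) (\<lambda>m z. \<Sum>k<m. fps_nth (fps_expansion \<phi> 0) k * z ^ k)
      (\<lambda>z. \<Sum>k. fps_nth (fps_expansion \<phi> 0) k * z ^ k) sequentially"
  proof (rule Weierstrass_m_test)
    show "summable (\<lambda>k. B * (r / r') ^ k)"
      using r r' by (intro summable_mult summable_geometric) auto
    fix k and z :: complex assume z: "z \<in> cball 0 r"
    have "norm (fps_nth (fps_expansion \<phi> 0) k * z ^ k) \<le> (B * (1 / r') ^ k) * r ^ k"
      unfolding norm_mult norm_power
      using z norm_fps_nth_le[OF \<phi> r'(1,2) B] by (intro mult_mono power_mono) (auto intro: order_trans[OF norm_ge_zero])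
    then show "norm (fps_nth (fps_expansion \<phi> 0) k * z ^ k) \<le> B * (r / r') ^ k"
      by (simp add: power_divide)
  qed
  moreover have "(\<Sum>k. fps_nth (fps_expansion \<phi> 0) k * z ^ k) = \<phi> z" if "z \<in> cball 0 r" for z
    using holomorphic_power_series[OF \<phi>, of z] that r by (simp add: fps_expansion_def sums_iff)
  then have "uniform_limit (cball 0 r) (\<lambda>m z. \<Sum>k<m. fps_nth (fps_expansion \<phi> 0) k * z ^ k)
      (\<lambda>z. \<Sum>k. fps_nth (fps_expansion \<phi> 0) k * z ^ k) sequentially \<longleftrightarrow> ?thesis"
    by (intro uniform_limit_cong') auto
  ultimately show ?thesis by blast
qed

text \<open>
  Multiplicativity is clear for polynomials and follows by continuity; this avoids a Cauchy product in the
  space of bounded operators, which is not an instance of the class of normed algebras.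
\<close>

lemma op_series_mult:
  assumes "\<phi> holomorphic_on ball 0 R" "\<psi> holomorphic_on ball 0 R" "R > 0"
  shows "op_series A (\<lambda>z. \<phi> z * \<psi> z) = op_series A \<phi> o\<^sub>L op_series A \<psi>"
proof -
  define r where "r = R / 2"
  have r: "0 < r" "r < R" using assms by (auto simp: r_def)
  let ?c = "fps_nth (fps_expansion \<phi> 0)"
  have "uniform_limit (sphere 0 r) (\<lambda>m z. (\<Sum>k<m. ?c k * z ^ k) * \<psi> z) (\<lambda>z. \<phi> z * \<psi> z) sequentially"
  proof (rule uniform_lim_mult)
    show "uniform_limit (sphere 0 r) (\<lambda>m z. \<Sum>k<m. ?c k * z ^ k) \<phi> sequentially"
      by (rule uniform_limit_on_subset[OF taylor_uniform_limit[OF assms(1) r]]) auto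
    show "uniform_limit (sphere 0 r) (\<lambda>m. \<psi>) \<psi> sequentially"
      by (rule uniform_limit_const)
    obtain B where "\<And>z. z \<in> sphere 0 r \<Longrightarrow> norm (\<phi> z) \<le> B"
      using holomorphic_bounded_on_sphere[OF assms(1) r] by blast
    then show "bounded (\<phi> ` sphere 0 r)" by (auto simp: bounded_iff intro!: exI[of _ B])
    obtain B where "\<And>z. z \<in> sphere 0 r \<Longrightarrow> norm (\<psi> z) \<le> B"
      using holomorphic_bounded_on_sphere[OF assms(2) r] by blast
    then show "bounded (\<psi> ` sphere 0 r)" by (auto simp: bounded_iff intro!: exI[of _ B])
  qed
  then have "(\<lambda>m. op_series A (\<lambda>z. (\<Sum>k<m. ?c k * z ^ k) * \<psi> z)) \<longlonglongrightarrow> op_series A (\<lambda>z. \<phi> z * \<psi> z)"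
    using assms by (intro op_series_tendsto[OF _ _ r]) (auto intro!: holomorphic_intros)
  then have "(\<lambda>m. (\<Sum>k<m. scale_op (?c k) (op_pow A k)) o\<^sub>L op_series A \<psi>) \<longlonglongrightarrow> op_series A (\<lambda>z. \<phi> z * \<psi> z)"
    by (simp add: op_series_mult_poly[OF assms(2,3)])
  moreover have "(\<lambda>m. (\<Sum>k<m. scale_op (?c k) (op_pow A k)) o\<^sub>L op_series A \<psi>) \<longlonglongrightarrow> (op_series A \<phi> o\<^sub>L op_series A \<psi>)"
    using op_series_sums[OF assms(1,3)] unfolding sums_def
    by (rule bounded_linear.tendsto[OF bounded_bilinear.bounded_linear_left[OF bounded_bilinear_blinfun_compose]])
  ultimately show ?thesis by (rule LIMSEQ_unique)
qed

lemma op_series_power: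
  assumes "\<phi> holomorphic_on ball 0 R" "R > 0"
  shows "op_series A (\<lambda>z. \<phi> z ^ n) = op_pow (op_series A \<phi>) n"
proof (induction n)
  case 0
  show ?case by (simp add: op_series_const)
next
  case (Suc n)
  then show ?case
    using op_series_mult[of \<phi> R "\<lambda>z. \<phi> z ^ n"] assms by (simp add: holomorphic_on_power)
qed

lemma op_series_poly_compose:
  assumes "\<phi> holomorphic_on ball 0 R" "R > 0"
  shows "op_series A (\<lambda>z. \<Sum>k<m. c k * \<phi> z ^ k) = (\<Sum>k<m. scale_op (c k) (op_pow (op_series A \<phi>) k))"
proof (induction m)
  case 0
  show ?case by (simp add: op_series_const scale_op.zero_left)
next
  case (Suc m)
  have h: "(\<lambda>z. \<phi> z ^ m) holomorphic_on ball 0 R"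
    using assms by (intro holomorphic_intros)
  have "op_series A (\<lambda>z. (\<Sum>k<m. c k * \<phi> z ^ k) + c m * \<phi> z ^ m) =
      (\<Sum>k<m. scale_op (c k) (op_pow (op_series A \<phi>) k)) + scale_op (c m) (op_pow (op_series A \<phi>) m)"
    using assms by (subst op_series_add[of _ R])
      (auto intro!: holomorphic_intros simp: Suc op_series_cmult[OF h] op_series_power[of _ R])
  then show ?case by simp
qed

lemma op_series_ident: "op_series A (\<lambda>z. z) = A"
  using op_series_mult_ident[of "\<lambda>z. 1" 1] by (simp add: op_series_const blinfun_eq_iff)

text \<open>Summing the termwise integrated resolvent series over the cycle turns its n-th
  coefficient into 2 pi i times the n-th Taylor coefficient of \<open>f\<close>, whichever cycle was
  chosen.\<close>

lemma riesz_dunford_eq_op_series: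
  assumes U: "open U" "0 \<in> U" and f: "f holomorphic_on U"
  shows "riesz_dunford U f A = op_series A f"
proof -
  define \<Gamma> where "\<Gamma> = (SOME \<Gamma>. surrounds \<Gamma> (spectrum A) U)"
  have sp: "spectrum A = {0}" using A by (simp add: quasinilpotent_def)
  have \<Gamma>: "surrounds \<Gamma> {0} U"
    unfolding \<Gamma>_def sp using surrounds_exists[OF U] by (rule someI_ex)
  \<comment> \<open>Stated for lists of members of the cycle because \<open>surrounds\<close> does
    not pass to tails, while the conditions on single paths do.\<close>
  have "(\<lambda>n. scale_op (\<Sum>\<gamma>\<leftarrow>\<Delta>. contour_integral \<gamma> (\<lambda>z. f z / z ^ Suc n)) (op_pow A n)) sums
      (\<Sum>\<gamma>\<leftarrow>\<Delta>. resolvent_integral f A \<gamma>)" if "set \<Delta> \<subseteq> set \<Gamma>" for \<Delta>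
    using that
  proof (induction \<Delta>)
    case Nil
    show ?case by (simp add: scale_op.zero_left)
  next
    case (Cons \<gamma> \<Delta>)
    have "valid_path \<gamma>" "path_image \<gamma> \<subseteq> U - {0}"
      using Cons.prems \<Gamma> by (auto simp: surrounds_def)
    then show ?case
      using sums_add[OF resolvent_integral_sums[OF A U(1) f] Cons.IH] Cons.prems
      by (simp add: scale_op.add_left)
  qed
  from this[OF order_refl]
  have "(\<lambda>n. scale_op (2 * pi * \<i> * fps_nth (fps_expansion f 0) n) (op_pow A n)) sums
      (\<Sum>\<gamma>\<leftarrow>\<Gamma>. resolvent_integral f A \<gamma>)"
    unfolding cycle_integral_eq_fps_nth[OF U f \<Gamma>] .
  then have "(\<lambda>n. scale_op (1 / (2 * of_real pi * \<i>)) (scale_op (2 * pi * \<i> * fps_nth (fps_expansion f 0) n) (op_pow A n))) sums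
      scale_op (1 / (2 * of_real pi * \<i>)) (\<Sum>\<gamma>\<leftarrow>\<Gamma>. resolvent_integral f A \<gamma>)"
    by (rule bounded_linear.sums[OF scale_op.bounded_linear_right])
  also have "scale_op (1 / (2 * of_real pi * \<i>)) (\<Sum>\<gamma>\<leftarrow>\<Gamma>. resolvent_integral f A \<gamma>) = riesz_dunford U f A"
    by (simp add: riesz_dunford_def \<Gamma>_def Let_def scale_op_def)
  finally show ?thesis
    by (simp add: op_series_def sums_iff scale_op_scale_op)
qed

section \<open>Recovering A from f(A) and transferring invariant subspaces\<close>

text \<open>The \<open>b\<close> are the Taylor coefficients at 0 of the local inverse of f -
  f(0).\<close>

lemma quasinilpotent_in_closed_algebra:
  assumes U: "open U" "0 \<in> U" and f: "f holomorphic_on U" "deriv f 0 \<noteq> 0"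
  obtains b :: "nat \<Rightarrow> complex"
  where "(\<lambda>k. scale_op (b k) (op_pow (op_series A f - scale_op (f 0) id_blinfun) k)) sums A"
proof -
  obtain R where R: "R > 0" "ball 0 R \<subseteq> U" "inj_on f (ball 0 R)"
    using has_complex_derivative_locally_injective[OF f(1) U(2,1) f(2)] by metis
  define F where "F z = f z - f 0" for z
  have f': "f holomorphic_on ball 0 R" using f R holomorphic_on_subset by blast
  have F: "F holomorphic_on ball 0 R"
    unfolding F_def using f' by (intro holomorphic_intros)
  have inj: "inj_on F (ball 0 R)" using R(3) by (auto simp: inj_on_def F_def)
  obtain g where g: "g holomorphic_on (F ` ball 0 R)" "\<And>z. z \<in> ball 0 R \<Longrightarrow> g (F z) = z"
    using holomorphic_has_inverse[OF F open_ball inj] by metis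
  have "open (F ` ball 0 R)" by (rule open_mapping_thm3[OF F open_ball inj])
  moreover have "0 \<in> F ` ball 0 R" using R by (auto simp: F_def image_iff intro!: bexI[of _ 0])
  ultimately obtain s' where s': "s' > 0" "ball 0 s' \<subseteq> F ` ball 0 R"
    using openE by blast
  \<comment> \<open>Strictly inside the disc where \<open>g\<close> is holomorphic, so its Taylor
    polynomials converge uniformly on \<open>cball 0 s\<close>.\<close>
  define s where "s = s' / 2"
  have s: "0 < s" "s < s'" using s' by (auto simp: s_def)
  have g': "g holomorphic_on ball 0 s'" using g s' holomorphic_on_subset by blast
  have "isCont F 0"
    using holomorphic_on_imp_continuous_on[OF F] R by (simp add: continuous_on_eq_continuous_at)
  then obtain d where d: "d > 0" "\<And>z. dist z 0 < d \<Longrightarrow> dist (F z) (F 0) < s"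
    using s unfolding continuous_at_eps_delta by blast
  \<comment> \<open>Small enough that \<open>F\<close> maps the circle of radius \<open>r\<close>
    into \<open>cball 0 s\<close> and that \<open>g\<close> inverts \<open>F\<close> there.\<close>
  define r where "r = min d R / 2"
  have r: "0 < r" "r < R" "r < d" using d R by (auto simp: r_def)
  have F_le: "F z \<in> cball 0 s" if "z \<in> sphere 0 r" for z
    using d(2)[of z] that r by (auto simp: F_def less_imp_le)
  let ?b = "fps_nth (fps_expansion g 0)"
  have "uniform_limit (sphere 0 r) (\<lambda>m z. \<Sum>k<m. ?b k * F z ^ k) (\<lambda>z. g (F z)) sequentially"
    by (rule uniform_limit_compose'[OF taylor_uniform_limit[OF g' s]]) (use F_le in auto)
  moreover have "uniform_limit (sphere 0 r) (\<lambda>m z. \<Sum>k<m. ?b k * F z ^ k) (\<lambda>z. g (F z)) sequentially \<longleftrightarrow>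
      uniform_limit (sphere 0 r) (\<lambda>m z. \<Sum>k<m. ?b k * F z ^ k) (\<lambda>z. z) sequentially"
    by (rule uniform_limit_cong') (use g(2) r in auto)
  ultimately have "uniform_limit (sphere 0 r) (\<lambda>m z. \<Sum>k<m. ?b k * F z ^ k) (\<lambda>z. z) sequentially"
    by blast
  then have "(\<lambda>m. op_series A (\<lambda>z. \<Sum>k<m. ?b k * F z ^ k)) \<longlonglongrightarrow> op_series A (\<lambda>z. z)"
    using F by (intro op_series_tendsto[OF _ _ r(1,2)]) (auto intro!: holomorphic_intros)
  then have "(\<lambda>k. scale_op (?b k) (op_pow (op_series A F) k)) sums A"
    by (simp add: op_series_poly_compose[OF F R(1)] op_series_ident sums_def)
  also have "op_series A F = op_series A f - scale_op (f 0) id_blinfun"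
    unfolding F_def using op_series_diff[of f R "\<lambda>z. f 0"] f' R by (simp add: op_series_const)
  finally show ?thesis using that by blast
qed

end

text \<open>The partial sums are polynomials in \<open>B\<close> and preserve \<open>M\<close>;
  applied to a vector of \<open>M\<close> they converge, and \<open>M\<close> is closed.\<close>

lemma closed_invariant_subspace_of_sums:
  assumes M: "closed_invariant_subspace B M"
    and A: "(\<lambda>k. scale_op (b k) (op_pow (B - scale_op c id_blinfun) k)) sums A"
  shows "closed_invariant_subspace A M"
proof -
  let ?N = "B - scale_op c id_blinfun"
  have sub: "0 \<in> M" "\<And>x y. x \<in> M \<Longrightarrow> y \<in> M \<Longrightarrow> x + y \<in> M" "\<And>a x. x \<in> M \<Longrightarrow> a *\<^sub>C x \<in> M"
    and cl: "closed M" and inv: "\<And>x. x \<in> M \<Longrightarrow> blinfun_apply B x \<in> M"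
    using M by (auto simp: closed_invariant_subspace_def complex_subspace_def)
  have N: "blinfun_apply ?N x \<in> M" if "x \<in> M" for x
    using sub(2)[OF inv[OF that] sub(3)[OF that, of "- c"]]
    by (simp add: blinfun.diff_left scaleC_minus_left)
  have pow: "blinfun_apply (op_pow ?N k) x \<in> M" if "x \<in> M" for x k
    by (induction k) (use that N in auto)
  have "blinfun_apply A x \<in> M" if x: "x \<in> M" for x
  proof (rule closed_sequentially[OF cl])
    have "blinfun_apply (\<Sum>k<m. scale_op (b k) (op_pow ?N k)) x \<in> M" for m
      by (induction m) (auto simp: blinfun.add_left sub pow x)
    then show "blinfun_apply (\<Sum>k<m. scale_op (b k) (op_pow ?N k)) x \<in> M" for m .
    show "(\<lambda>m. blinfun_apply (\<Sum>k<m. scale_op (b k) (op_pow ?N k)) x) \<longlonglongrightarrow> blinfun_apply A x"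
      using A unfolding sums_def by (intro blinfun.tendsto tendsto_const)
  qed
  then show ?thesis
    using M by (auto simp: closed_invariant_subspace_def)
qed

theorem corollary4p4:
  fixes A :: "'a::complex_hilbert \<Rightarrow>\<^sub>L 'a"
    and f :: "complex \<Rightarrow> complex"
    and U :: "complex set"
  assumes "complex_linear A"
    and "quasinilpotent A"
    and "unicellular A"
    and "open U"
    and "0 \<in> U"
    and "f analytic_on U"
    and "deriv f 0 \<noteq> 0"
  shows "unicellular (riesz_dunford U f A)"
proof -
  have f: "f holomorphic_on U" using assms(6) by (rule analytic_imp_holomorphic)
  obtain b where b: "(\<lambda>k. scale_op (b k) (op_pow (op_series A f - scale_op (f 0) id_blinfun) k)) sums A"
    using quasinilpotent_in_closed_algebra[OF assms(1,2,4,5) f assms(7)] by blast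
  show ?thesis
    unfolding riesz_dunford_eq_op_series[OF assms(1,2,4,5) f]
    using assms(3) closed_invariant_subspace_of_sums[OF _ b] unfolding unicellular_def by blast
qed

end
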